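(* Let $\alpha,\beta\in(0,\infty]$, $a:=\alpha^{-1}$, $b:=\beta^{-1}$ (with $\infty^{-1}=0$), and let $n\ge1$ (with $n\ge2$ if $\alpha=\beta=\infty$). Let $A_{n,\alpha,\beta}=A(S_{n,\alpha,\beta})$ be the number of symbols $\alpha$ on the diagonal of the random $\alpha/\beta$-staircase tableau $S_{n,\alpha,\beta}$. Then the probability generating function $g_A(x)=\mathbb E\,x^{A_{n,\alpha,\beta}}$ has all its roots simple and on the negative halfline $(-\infty,0]$. As a consequence, for any given $n,\alpha,\beta$ there exist $p_1,\dots,p_n\in[0,1]$ such that $$A_{n,\alpha,\beta}\overset{\mathrm d}{=}\sum_{i=1}^n \operatorname{Be}(p_i),$$ where $\operatorname{Be}(p_i)$ is a Bernoulli random variable with parameter $p_i$ and the summands are independent. It follows that the distribution of $A_{n,\alpha,\beta}$ and the sequence $v_{a,b}(n,k)$, $k\in\mathbb Z$, are unimodal and log-concave.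
   Context: An $\alpha/\beta$-staircase tableau of size $n\ge1$ is a filling of the Young diagram of shape $(n,n-1,\dots,2,1)$, whose boxes are $(i,j)$ (row $i$ from the top, column $j$ from the left) with $i,j\ge1$, $i+j\le n+1$, such that: each box is empty or contains one of the symbols $\alpha,\beta$; no diagonal box (box with $i+j=n+1$) is empty; all boxes in the same row and to the left of a $\beta$ are empty; all boxes in the same column and above an $\alpha$ are empty. Let $\bar{\mathcal S}_n$ be the set of these tableaux. For $S\in\bar{\mathcal S}_n$ let $N_\alpha(S),N_\beta(S)$ be the numbers of symbols $\alpha$ and $\beta$ in $S$, and $A(S)$ the number of symbols $\alpha$ in diagonal boxes. For parameter values $\alpha,\beta\in(0,\infty)$, $S_{n,\alpha,\beta}$ is the random element of $\bar{\mathcal S}_n$ with $\mathbb P(S_{n,\alpha,\beta}=S)=\alpha^{N_\alpha(S)}\beta^{N_\beta(S)}/Z_n(\alpha,\beta)$, where $Z_n(\alpha,\beta)=\sum_{S\in\bar{\mathcal S}_n}\alpha^{N_\alpha(S)}\beta^{N_\beta(S)}$. If exactly one of $\alpha,\beta$ is $\infty$, the distribution is the limit of this one as that parameter tends to $\infty$ with the other fixed; if $\alpha=\beta=\infty$, it is the limit as $\alpha=\beta\to\infty$. The numbers $v_{a,b}(n,k)$, $k\in\mathbb Z$, $n\ge0$, are defined by $v_{a,b}(0,0)=1$, $v_{a,b}(0,k)=0$ for $k\ne0$, and $$v_{a,b}(n,k)=(k+a)v_{a,b}(n-1,k)+(n-k+b)v_{a,b}(n-1,k-1),\qquad n\ge1.$$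 *)

theory Defs
  imports "HOL-Probability.Probability" "HOL-Computational_Algebra.Polynomial"
begin

section \<open>Staircase tableaux\<close>

datatype symbol = Alpha | Beta

text \<open>A filling maps a pair (row, column) to its content, \<open>None\<close> being the empty box.\<close>

type_synonym filling = "nat \<times> nat \<Rightarrow> symbol option"

definition boxes :: "nat \<Rightarrow> (nat \<times> nat) set" where
  "boxes n = {(i, j). 1 \<le> i \<and> 1 \<le> j \<and> i + j \<le> n + 1}"

text \<open>Fillings are \<open>None\<close> outside the diagram, so that each tableau has a unique representative.\<close>

definition tableaux :: "nat \<Rightarrow> filling set" where
  "tableaux n = {S.
     (\<forall>p. p \<notin> boxes n \<longrightarrow> S p = None) \<and>
     (\<forall>(i, j) \<in> boxes n. i + j = n + 1 \<longrightarrow> S (i, j) \<noteq> None) \<and>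
     (\<forall>(i, j) \<in> boxes n. S (i, j) = Some Beta \<longrightarrow> (\<forall>j' < j. S (i, j') = None)) \<and>
     (\<forall>(i, j) \<in> boxes n. S (i, j) = Some Alpha \<longrightarrow> (\<forall>i' < i. S (i', j) = None))}"

definition N_alpha :: "filling \<Rightarrow> nat" where
  "N_alpha S = card {p. S p = Some Alpha}"

definition N_beta :: "filling \<Rightarrow> nat" where
  "N_beta S = card {p. S p = Some Beta}"

definition diag_alpha :: "nat \<Rightarrow> filling \<Rightarrow> nat" where
  "diag_alpha n S = card {(i, j) \<in> boxes n. i + j = n + 1 \<and> S (i, j) = Some Alpha}"


section \<open>The random staircase tableau\<close>

definition weight :: "real \<Rightarrow> real \<Rightarrow> filling \<Rightarrow> real" where
  "weight \<alpha> \<beta> S = \<alpha> ^ N_alpha S * \<beta> ^ N_beta S"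

definition Z_tab :: "nat \<Rightarrow> real \<Rightarrow> real \<Rightarrow> real" where
  "Z_tab n \<alpha> \<beta> = (\<Sum>S \<in> tableaux n. weight \<alpha> \<beta> S)"

definition tableau_prob :: "nat \<Rightarrow> real \<Rightarrow> real \<Rightarrow> filling \<Rightarrow> real" where
  "tableau_prob n \<alpha> \<beta> S = (if S \<in> tableaux n then weight \<alpha> \<beta> S / Z_tab n \<alpha> \<beta> else 0)"

text \<open>
  For infinite parameters the distribution is the pointwise limit; as \<open>tableaux n\<close> is finite, this
  is convergence in distribution. If both parameters are infinite, they tend to infinity along
  the diagonal.
\<close>

definition tableau_prob_ext :: "nat \<Rightarrow> ereal \<Rightarrow> ereal \<Rightarrow> filling \<Rightarrow> real" where
  "tableau_prob_ext n \<alpha> \<beta> S =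
     (if \<alpha> = \<infinity> \<and> \<beta> = \<infinity> then Lim at_top (\<lambda>x. tableau_prob n x x S)
      else if \<alpha> = \<infinity> then Lim at_top (\<lambda>x. tableau_prob n x (real_of_ereal \<beta>) S)
      else if \<beta> = \<infinity> then Lim at_top (\<lambda>x. tableau_prob n (real_of_ereal \<alpha>) x S)
      else tableau_prob n (real_of_ereal \<alpha>) (real_of_ereal \<beta>) S)"

definition random_tableau :: "nat \<Rightarrow> ereal \<Rightarrow> ereal \<Rightarrow> filling pmf" where
  "random_tableau n \<alpha> \<beta> = embed_pmf (tableau_prob_ext n \<alpha> \<beta>)"

text \<open>
  \<open>Lim\<close> and \<open>embed_pmf\<close> are total, so we check that the limits exist and
  define a probability distribution.
\<close>

lemma finite_boxes: "finite (boxes n)"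
proof (rule finite_subset)
  show "boxes n \<subseteq> {..n + 1} \<times> {..n + 1}" by (auto simp: boxes_def)
qed simp

lemma finite_tableaux: "finite (tableaux n)"
proof (rule finite_subset)
  have "finite (UNIV :: symbol option set)"
  proof (rule finite_subset)
    show "(UNIV :: symbol option set) \<subseteq> {None, Some Alpha, Some Beta}"
    proof
      fix x :: "symbol option"
      show "x \<in> {None, Some Alpha, Some Beta}"
        by (cases x; cases "the x") simp_all
    qed
  qed simp
  then show "finite {S :: filling. \<forall>p. (p \<in> boxes n \<longrightarrow> S p \<in> UNIV) \<and> (p \<notin> boxes n \<longrightarrow> S p = None)}"
    by (intro finite_set_of_finite_funs finite_boxes)
qed (auto simp: tableaux_def)

lemma tableaux_nonempty: "tableaux n \<noteq> {}"
proof -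
  have "(\<lambda>(i, j). if (i, j) \<in> boxes n \<and> i + j = n + 1 then Some Alpha else None) \<in> tableaux n"
    by (auto simp: tableaux_def)
  then show ?thesis by blast
qed

lemma ratio_tendsto:
  fixes c :: "'a \<Rightarrow> real" and m :: "'a \<Rightarrow> nat"
  assumes fin: "finite T" and s: "s \<in> T" and pos: "\<And>t. t \<in> T \<Longrightarrow> c t > 0"
  shows "\<exists>L. ((\<lambda>x. c s * x ^ m s / (\<Sum>t\<in>T. c t * x ^ m t)) \<longlongrightarrow> L) at_top"
proof -
  define M where "M = Max (m ` T)"
  have M: "m t \<le> M" if "t \<in> T" for t
    using fin that by (simp add: M_def)
  have "M \<in> m ` T" unfolding M_def using fin s by (intro Max_in) auto
  then obtain u where u: "u \<in> T" "m u = M" by blast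
  define l where "l t = (if m t = M then c t else 0)" for t
  have lim: "((\<lambda>x. c t * x ^ m t / x ^ M) \<longlongrightarrow> l t) at_top" if "t \<in> T" for t
  proof (cases "m t = M")
    case True
    have "\<forall>\<^sub>F x in at_top. c t * x ^ m t / x ^ M = l t"
      using eventually_gt_at_top[of 0] by eventually_elim (simp add: True l_def)
    then show ?thesis by (rule tendsto_eventually)
  next
    case False
    then have lt: "m t < M" using M[OF that] by simp
    have "filterlim (\<lambda>x::real. x ^ (M - m t)) at_top at_top"
      using lt by (intro filterlim_pow_at_top filterlim_ident) auto
    then have "((\<lambda>x. c t / x ^ (M - m t)) \<longlongrightarrow> 0) at_top"
      by (intro real_tendsto_divide_at_top[OF tendsto_const])
    moreover have "\<forall>\<^sub>F x in at_top. c t / x ^ (M - m t) = c t * x ^ m t / x ^ M"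
      using eventually_gt_at_top[of 0]
      by eventually_elim (use lt in \<open>simp add: power_diff\<close>)
    ultimately show ?thesis using False by (simp add: l_def tendsto_cong)
  qed
  have "sum l T > 0"
    using u pos by (intro sum_pos2[OF fin u(1)]) (auto simp: l_def less_imp_le)
  then have "((\<lambda>x. (c s * x ^ m s / x ^ M) / (\<Sum>t\<in>T. c t * x ^ m t / x ^ M)) \<longlongrightarrow> l s / sum l T) at_top"
    by (intro tendsto_divide tendsto_sum lim s) auto
  moreover have "\<forall>\<^sub>F x in at_top. (c s * x ^ m s / x ^ M) / (\<Sum>t\<in>T. c t * x ^ m t / x ^ M)
      = c s * x ^ m s / (\<Sum>t\<in>T. c t * x ^ m t)"
    using eventually_gt_at_top[of 0]
    by eventually_elim (simp flip: sum_divide_distrib)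
  ultimately have "((\<lambda>x. c s * x ^ m s / (\<Sum>t\<in>T. c t * x ^ m t)) \<longlongrightarrow> l s / sum l T) at_top"
    by (rule Lim_transform_eventually)
  then show ?thesis by blast
qed

lemma tableau_prob_tendsto:
  assumes "\<alpha> > 0" "\<beta> > 0"
  shows "((\<lambda>x. tableau_prob n x x S) \<longlongrightarrow> tableau_prob_ext n \<infinity> \<infinity> S) at_top"
    and "((\<lambda>x. tableau_prob n x \<beta> S) \<longlongrightarrow> tableau_prob_ext n \<infinity> (ereal \<beta>) S) at_top"
    and "((\<lambda>x. tableau_prob n \<alpha> x S) \<longlongrightarrow> tableau_prob_ext n (ereal \<alpha>) \<infinity> S) at_top"
proof -
  have L: "(f \<longlongrightarrow> Lim at_top f) at_top" if "\<exists>L. (f \<longlongrightarrow> L) at_top" for f :: "real \<Rightarrow> real"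
    using that tendsto_Lim[of at_top f] by auto
  have "\<exists>L. ((\<lambda>x. tableau_prob n x x S) \<longlongrightarrow> L) at_top"
    using ratio_tendsto[OF finite_tableaux, of S n "\<lambda>_. 1" "\<lambda>S. N_alpha S + N_beta S"]
    by (cases "S \<in> tableaux n")
      (auto simp: tableau_prob_def weight_def Z_tab_def power_add intro: exI[of _ 0])
  from L[OF this]
  show "((\<lambda>x. tableau_prob n x x S) \<longlongrightarrow> tableau_prob_ext n \<infinity> \<infinity> S) at_top"
    by (simp add: tableau_prob_ext_def)
  have "\<exists>L. ((\<lambda>x. tableau_prob n x \<beta> S) \<longlongrightarrow> L) at_top"
    using ratio_tendsto[OF finite_tableaux, of S n "\<lambda>S. \<beta> ^ N_beta S" N_alpha] assms
    by (cases "S \<in> tableaux n")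
      (auto simp: tableau_prob_def weight_def Z_tab_def mult.commute intro: exI[of _ 0])
  from L[OF this]
  show "((\<lambda>x. tableau_prob n x \<beta> S) \<longlongrightarrow> tableau_prob_ext n \<infinity> (ereal \<beta>) S) at_top"
    by (simp add: tableau_prob_ext_def)
  have "\<exists>L. ((\<lambda>x. tableau_prob n \<alpha> x S) \<longlongrightarrow> L) at_top"
    using ratio_tendsto[OF finite_tableaux, of S n "\<lambda>S. \<alpha> ^ N_alpha S" N_beta] assms
    by (cases "S \<in> tableaux n")
      (auto simp: tableau_prob_def weight_def Z_tab_def intro: exI[of _ 0])
  from L[OF this]
  show "((\<lambda>x. tableau_prob n \<alpha> x S) \<longlongrightarrow> tableau_prob_ext n (ereal \<alpha>) \<infinity> S) at_top"
    by (simp add: tableau_prob_ext_def)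
qed

lemma Z_tab_pos: "\<alpha> > 0 \<Longrightarrow> \<beta> > 0 \<Longrightarrow> Z_tab n \<alpha> \<beta> > 0"
  unfolding Z_tab_def by (rule sum_pos[OF finite_tableaux tableaux_nonempty]) (simp add: weight_def)

lemma tableau_prob_nonneg: "\<alpha> > 0 \<Longrightarrow> \<beta> > 0 \<Longrightarrow> tableau_prob n \<alpha> \<beta> S \<ge> 0"
  using Z_tab_pos[of \<alpha> \<beta> n] by (auto simp: tableau_prob_def weight_def intro!: divide_nonneg_pos)

lemma tableau_prob_sum:
  "\<alpha> > 0 \<Longrightarrow> \<beta> > 0 \<Longrightarrow> (\<Sum>S \<in> tableaux n. tableau_prob n \<alpha> \<beta> S) = 1"
proof -
  assume "\<alpha> > 0" "\<beta> > 0"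
  then have "Z_tab n \<alpha> \<beta> \<noteq> 0" using Z_tab_pos[of \<alpha> \<beta> n] by simp
  moreover have "(\<Sum>S \<in> tableaux n. tableau_prob n \<alpha> \<beta> S) = Z_tab n \<alpha> \<beta> / Z_tab n \<alpha> \<beta>"
    unfolding Z_tab_def sum_divide_distrib by (rule sum.cong) (simp_all add: tableau_prob_def Z_tab_def)
  ultimately show ?thesis by simp
qed

lemma tableau_prob_limit:
  fixes f g :: "real \<Rightarrow> real"
  assumes lim: "\<And>S. ((\<lambda>x. tableau_prob n (f x) (g x) S) \<longlongrightarrow> q S) at_top"
    and ev: "\<forall>\<^sub>F x in at_top. f x > 0 \<and> g x > 0"
  shows "q S \<ge> 0" "S \<notin> tableaux n \<Longrightarrow> q S = 0" "sum q (tableaux n) = 1"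
proof -
  have ntriv: "(at_top :: real filter) \<noteq> bot" by simp
  show "q S \<ge> 0"
  proof (rule tendsto_lowerbound[OF lim _ ntriv])
    show "\<forall>\<^sub>F x in at_top. 0 \<le> tableau_prob n (f x) (g x) S"
      using ev by (rule eventually_mono) (blast intro: tableau_prob_nonneg)
  qed
  show "q S = 0" if "S \<notin> tableaux n"
    using tendsto_unique[OF ntriv lim[of S]] that by (simp add: tableau_prob_def)
  have "((\<lambda>x. \<Sum>S\<in>tableaux n. tableau_prob n (f x) (g x) S) \<longlongrightarrow> sum q (tableaux n)) at_top"
    by (intro tendsto_sum lim)
  moreover have "((\<lambda>x. \<Sum>S\<in>tableaux n. tableau_prob n (f x) (g x) S) \<longlongrightarrow> 1) at_top"
    using ev by (intro tendsto_eventually) (erule eventually_mono, blast intro: tableau_prob_sum)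
  ultimately show "sum q (tableaux n) = 1"
    using tendsto_unique[OF ntriv] by blast
qed

lemma pmf_random_tableau:
  assumes "\<alpha> > 0" "\<beta> > 0"
  shows "pmf (random_tableau n \<alpha> \<beta>) S = tableau_prob_ext n \<alpha> \<beta> S"
proof -
  let ?q = "tableau_prob_ext n \<alpha> \<beta>"
  have *: "(\<forall>S. ?q S \<ge> 0) \<and> (\<forall>S. S \<notin> tableaux n \<longrightarrow> ?q S = 0) \<and> sum ?q (tableaux n) = 1"
  proof -
    obtain f g :: "real \<Rightarrow> real" where fg: "\<And>S. ((\<lambda>x. tableau_prob n (f x) (g x) S) \<longlongrightarrow> ?q S) at_top"
      "\<forall>\<^sub>F x in at_top. f x > 0 \<and> g x > 0"
    proof (cases "\<alpha> = \<infinity>"; cases "\<beta> = \<infinity>")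
      assume "\<alpha> = \<infinity>" "\<beta> = \<infinity>"
      then show ?thesis
        using that[of "\<lambda>x. x" "\<lambda>x. x"] tableau_prob_tendsto(1)[of 1 1 n] eventually_gt_at_top[of 0]
        by auto
    next
      assume "\<alpha> = \<infinity>" "\<beta> \<noteq> \<infinity>"
      with assms obtain b where "\<beta> = ereal b" "b > 0" by (cases \<beta>) auto
      then show ?thesis
        using that[of "\<lambda>x. x" "\<lambda>_. b"] tableau_prob_tendsto(2)[of 1 b n] eventually_gt_at_top[of 0]
          \<open>\<alpha> = \<infinity>\<close> by auto
    next
      assume "\<alpha> \<noteq> \<infinity>" "\<beta> = \<infinity>"
      with assms obtain a where "\<alpha> = ereal a" "a > 0" by (cases \<alpha>) auto
      then show ?thesis
        using that[of "\<lambda>_. a" "\<lambda>x. x"] tableau_prob_tendsto(3)[of a 1 n] eventually_gt_at_top[of 0]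
          \<open>\<beta> = \<infinity>\<close> by auto
    next
      assume "\<alpha> \<noteq> \<infinity>" "\<beta> \<noteq> \<infinity>"
      with assms obtain a b where "\<alpha> = ereal a" "a > 0" "\<beta> = ereal b" "b > 0"
        by (cases \<alpha>; cases \<beta>) auto
      then show ?thesis
        using that[of "\<lambda>_. a" "\<lambda>_. b"] by (simp add: tableau_prob_ext_def)
    qed
    from tableau_prob_limit[OF fg] show ?thesis by blast
  qed
  have "(\<integral>\<^sup>+ S. ennreal (?q S) \<partial>count_space UNIV) = (\<Sum>S\<in>tableaux n. ennreal (?q S))"
    by (rule nn_integral_count_space'[OF finite_tableaux]) (use * in auto)
  also have "\<dots> = 1" using * by (simp add: sum_ennreal)
  finally show ?thesis
    unfolding random_tableau_def using * by (intro pmf_embed_pmf) auto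
qed


section \<open>The recursive numbers and properties of sequences\<close>

fun vnum :: "real \<Rightarrow> real \<Rightarrow> nat \<Rightarrow> int \<Rightarrow> real" where
  "vnum a b 0 k = (if k = 0 then 1 else 0)"
| "vnum a b (Suc n) k =
     (real_of_int k + a) * vnum a b n k + (real (Suc n) - real_of_int k + b) * vnum a b n (k - 1)"

definition unimodal :: "(int \<Rightarrow> real) \<Rightarrow> bool" where
  "unimodal u \<longleftrightarrow> (\<exists>m. mono_on {..m} u \<and> antimono_on {m..} u)"

definition log_concave :: "(int \<Rightarrow> real) \<Rightarrow> bool" where
  "log_concave u \<longleftrightarrow> (\<forall>k. u (k - 1) * u (k + 1) \<le> (u k)\<^sup>2)"

end

theory Submission
  imports Defs
begin

text \<open>
  Let \<open>a = 1 / \<alpha>\<close> and \<open>b = 1 / \<beta>\<close>, and let \<open>P\<^sub>n\<close> be the polynomial with the coefficients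
  \<open>v\<^sub>a\<^sub>,\<^sub>b(n, k)\<close>, called \<open>euler_poly a b n\<close> here. Everything follows from two facts about it.

  The first one is combinatorial: up to a constant, \<open>P\<^sub>n\<close> is the generating function of the number of
  symbols \<open>\<alpha>\<close> on the diagonal, if the parameters are finite. A tableau is built up by
  adding columns on the left. What a new column may contain depends on the earlier ones only through
  the rows without \<open>\<beta>\<close>, so these rows are marked by a further variable \<open>y\<close>. In the resulting recursion a column changes \<open>y\<close> to \<open>y + \<beta>\<close>, i.e.
  \<open>b y\<close> to \<open>b y + 1\<close>, and a second recursion of the \<open>P\<^sub>n\<close> that shifts \<open>b\<close> (\<open>euler_poly_shift\<close>) shows
  that the generating function with weights \<open>y\<close> is \<open>(\<alpha> \<beta>)\<^sup>n P\<^sub>n\<close> with \<open>b y\<close> in place of \<open>b\<close>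
  (\<open>tableaux_generating_function\<close>).

  The second one is analytic: for \<open>a, b > 0\<close> the polynomial \<open>P\<^sub>n\<close> has \<open>n\<close> simple negative roots. This
  follows by induction from \<open>P\<^sub>n\<^sub>+\<^sub>1 = (a + (n + b) x) P\<^sub>n + x (1 - x) P\<^sub>n'\<close>: at the roots of \<open>P\<^sub>n\<close> only the
  derivative term survives, its signs alternate, and the intermediate value theorem yields
  interlacing roots of \<open>P\<^sub>n\<^sub>+\<^sub>1\<close> (\<open>euler_poly_step_roots\<close>). A parameter equal to \<open>0\<close> is reduced to
  positive parameters by \<open>euler_poly_a_0\<close> and \<open>euler_poly_b_0\<close>.

  Infinite parameters are treated by continuity. The generating function of the limit distribution
  is the limit of \<open>P\<^sub>n(x) / P\<^sub>n(1)\<close>, and only for \<open>\<alpha> = \<beta> = \<infinity>\<close>, where \<open>P\<^sub>n\<close> tends to zero, is a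
  rescaling necessary (\<open>diag_alpha_pgf\<close>).

  Hence the generating function is always \<open>c (\<Prod>r\<in>R. x + r)\<close> with a finite set \<open>R\<close> of nonnegative
  numbers. Its factors are, up to constants, generating functions of Bernoulli variables
  (\<open>bernoulli_sum_if_pgf_real_rooted\<close>), and multiplication by \<open>x + r\<close> preserves a form of log-concavity
  that excludes internal zeros and therefore implies unimodality.
\<close>


section \<open>Generalised Eulerian polynomials\<close>

text \<open>
  This is the polynomial \<open>P\<^sub>n(x) = (\<Sum>k. v\<^sub>a\<^sub>,\<^sub>b(n, k) x\<^sup>k)\<close>, a generalised Eulerian polynomial. Multiplying the
  recursion of the \<open>v\<^sub>a\<^sub>,\<^sub>b(n, k)\<close> by \<open>x\<^sup>k\<close> and summing turns the factors \<open>k\<close> into derivatives: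
  \<open>P\<^sub>n\<^sub>+\<^sub>1 = (a + (n + b) x) P\<^sub>n + x (1 - x) P\<^sub>n'\<close>.
\<close>

primrec euler_poly :: "real \<Rightarrow> real \<Rightarrow> nat \<Rightarrow> real poly" where
  "euler_poly a b 0 = 1"
| "euler_poly a b (Suc n) =
     [:a, real n + b:] * euler_poly a b n + [:0, 1, -1:] * pderiv (euler_poly a b n)"

lemma vnum_eq_coeff_euler_poly:
  "vnum a b n k = (if k < 0 then 0 else coeff (euler_poly a b n) (nat k))"
proof (induction n arbitrary: k)
  case 0
  then show ?case by (auto simp: coeff_1)
next
  case (Suc n)
  consider "k < 0" | "k = 0" | j where "k = int (Suc j)"
    by (metis linorder_neqE_linordered_idom zero_less_imp_eq_int gr0_implies_Suc of_nat_0_less_iff)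
  then show ?case
  proof cases
    case 3
    let ?c = "coeff (euler_poly a b n)"
    have "int (Suc j) - 1 = int j" "nat (int (Suc j)) = Suc j" by simp_all
    then have "vnum a b (Suc n) k = (real (Suc j) + a) * ?c (Suc j) + (real n - real j + b) * ?c j"
      unfolding 3 vnum.simps(2) Suc.IH by simp
    also have "\<dots> = coeff (euler_poly a b (Suc n)) (Suc j)"
      by (cases j) (simp_all add: coeff_pderiv algebra_simps)
    finally show ?thesis by (simp add: 3 del: euler_poly.simps vnum.simps of_nat_Suc)
  qed (simp_all add: Suc.IH)
qed

text \<open>
  The differential recursion keeps \<open>b\<close> fixed, whereas adding a column to a tableau involves \<open>b + 1\<close>.
  This identity connects the two: both terms on the right obey the differential recursion of
  \<open>P\<^sub>n\<^sub>+\<^sub>1\<close> (for the first one because the derivative of \<open>x - 1\<close> lowers the coefficient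
  \<open>n + 1 + b\<close> to \<open>n + b\<close>), so it is enough to compare the two sides at \<open>n = 0\<close>.
\<close>

lemma euler_poly_shift:
  "euler_poly a b (Suc n) =
     smult b ([:-1, 1:] * euler_poly a b n) + smult (a + b) (euler_poly a (b + 1) n)"
proof (induction n)
  case 0
  then show ?case by (simp add: one_pCons)
next
  case (Suc n)
  define U V where "U = euler_poly a b n" and "V = euler_poly a (b + 1) n"
  have IH: "euler_poly a b (Suc n) = smult b ([:-1, 1:] * U) + smult (a + b) V"
    using Suc.IH by (simp only: U_def V_def)
  have D: "pderiv ([:-1, 1:] * U) = U + [:-1, 1:] * pderiv U"
    unfolding pderiv_mult by (simp add: pderiv_pCons)
  have "poly (euler_poly a b (Suc (Suc n))) x = poly (smult b ([:-1, 1:] * euler_poly a b (Suc n)) +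
          smult (a + b) (euler_poly a (b + 1) (Suc n))) x" for x
  proof -
    have "poly (euler_poly a b (Suc (Suc n))) x =
        (a + (real n + 1 + b) * x) * (b * (x - 1) * poly U x + (a + b) * poly V x)
        + x * (1 - x) * (b * (poly U x + (x - 1) * poly (pderiv U) x) + (a + b) * poly (pderiv V) x)"
      unfolding euler_poly.simps(2)[of a b "Suc n"] IH pderiv_add pderiv_smult D
      by (simp add: algebra_simps)
    also have "\<dots> = b * (x - 1) * ((a + (real n + b) * x) * poly U x + x * (1 - x) * poly (pderiv U) x)
        + (a + b) * ((a + (real n + 1 + b) * x) * poly V x + x * (1 - x) * poly (pderiv V) x)"
      by algebra
    also have "(a + (real n + b) * x) * poly U x + x * (1 - x) * poly (pderiv U) x
        = poly (euler_poly a b (Suc n)) x"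
      by (simp add: algebra_simps flip: U_def)
    also have "(a + (real n + 1 + b) * x) * poly V x + x * (1 - x) * poly (pderiv V) x
        = poly (euler_poly a (b + 1) (Suc n)) x"
      unfolding V_def by (simp add: algebra_simps)
    finally show ?thesis by (simp add: algebra_simps del: euler_poly.simps)
  qed
  then show ?case by (intro poly_ext) blast
qed

text \<open>
  A vanishing parameter can be traded for the value \<open>1\<close> at the cost of one step of the recursion;
  this reduces infinite \<open>\<beta>\<close> or \<open>\<alpha>\<close> to positive finite parameters.
\<close>

lemma euler_poly_b_0: "euler_poly a 0 (Suc n) = smult a (euler_poly a 1 n)"
  by (subst euler_poly_shift) simp

lemma euler_poly_a_0: "euler_poly 0 b (Suc n) = smult b ([:0, 1:] * euler_poly 1 b n)"
proof (induction n)
  case 0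
  then show ?case by (simp add: one_pCons)
next
  case (Suc n)
  define U where "U = euler_poly 1 b n"
  have IH: "euler_poly 0 b (Suc n) = smult b ([:0, 1:] * U)"
    using Suc.IH by (simp only: U_def)
  have "poly (euler_poly 0 b (Suc (Suc n))) x =
          poly (smult b ([:0, 1:] * euler_poly 1 b (Suc n))) x" for x
    unfolding euler_poly.simps(2)[of 0 b "Suc n"] IH
    by (simp add: pderiv_smult pderiv_mult pderiv_pCons algebra_simps flip: U_def)
  then show ?case by (intro poly_ext) blast
qed

lemma poly_euler_poly_1_pos:
  assumes "a \<ge> 0" "b \<ge> 0" "a + b > 0"
  shows "poly (euler_poly a b n) 1 > 0"
proof (induction n)
  case (Suc n)
  have "poly (euler_poly a b (Suc n)) 1 = (a + b + n) * poly (euler_poly a b n) 1"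
    by (simp add: algebra_simps)
  then show ?case using Suc assms by simp
qed simp

lemma tendsto_poly_euler_poly:
  assumes "(f \<longlongrightarrow> a) F" "(g \<longlongrightarrow> b) F"
  shows "((\<lambda>t. poly (euler_poly (f t) (g t) n) x) \<longlongrightarrow> poly (euler_poly a b n) x) F"
proof -
  have coeff: "((\<lambda>t. coeff (euler_poly (f t) (g t) n) k) \<longlongrightarrow> coeff (euler_poly a b n) k) F" for k
  proof -
    have "((\<lambda>t. vnum (f t) (g t) n j) \<longlongrightarrow> vnum a b n j) F" for j
      by (induction n arbitrary: j) (auto intro!: tendsto_intros assms)
    from this[of "int k"] show ?thesis by (simp add: vnum_eq_coeff_euler_poly)
  qed
  have deg: "degree (euler_poly a b n) \<le> n" for a b
  proof (induction n)
    case (Suc n)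
    have "degree ([:a, real n + b:] * euler_poly a b n) \<le> Suc n"
      using degree_mult_le[of "[:a, real n + b:]" "euler_poly a b n"] Suc by (simp split: if_splits)
    moreover have "degree ([:0, 1, -1:] * pderiv (euler_poly a b n)) \<le> Suc n"
    proof (cases "degree (euler_poly a b n) = 0")
      case True
      then have "pderiv (euler_poly a b n) = 0" by (simp add: pderiv_eq_0_iff)
      then show ?thesis by simp
    next
      case False
      then show ?thesis
        using degree_mult_le[of "[:0, 1, -1:]" "pderiv (euler_poly a b n)"] Suc
        by (simp add: degree_pderiv)
    qed
    ultimately show ?case by (simp only: euler_poly.simps degree_add_le)
  qed simp
  have eq: "poly (euler_poly a b n) x = (\<Sum>k\<le>n. coeff (euler_poly a b n) k * x ^ k)" for a b
    by (subst poly_as_sum_of_monoms'[OF deg, symmetric]) (simp add: poly_sum poly_monom)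
  show ?thesis unfolding eq by (intro tendsto_intros coeff)
qed


section \<open>Coefficients of polynomials with real roots\<close>

text \<open>
  Log-concavity of neighbours alone is not preserved by multiplication with \<open>x + r\<close> and does not
  imply unimodality, because of possible internal zeros. Comparing arbitrary pairs \<open>i \<le> j\<close> repairs
  both. The condition says that all minors of order 1 and 2 of the Toeplitz matrix of \<open>u\<close> are
  nonnegative.
\<close>

definition log_concave_gap :: "(int \<Rightarrow> real) \<Rightarrow> bool" where
  "log_concave_gap u \<longleftrightarrow>
     (\<forall>k. u k \<ge> 0) \<and> (\<forall>i j. i \<le> j \<longrightarrow> u (i - 1) * u (j + 1) \<le> u i * u j)"

lemma log_concave_gap_imp_log_concave: "log_concave_gap u \<Longrightarrow> log_concave u"
  by (auto simp: log_concave_gap_def log_concave_def power2_eq_square)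

lemma log_concave_gap_scale:
  assumes "log_concave_gap u" "c \<ge> 0"
  shows "log_concave_gap (\<lambda>k. c * u k)"
  unfolding log_concave_gap_def
proof (intro conjI allI impI)
  fix i j :: int assume "i \<le> j"
  then have "c\<^sup>2 * (u (i - 1) * u (j + 1)) \<le> c\<^sup>2 * (u i * u j)"
    using assms by (intro mult_left_mono) (auto simp: log_concave_gap_def)
  then show "c * u (i - 1) * (c * u (j + 1)) \<le> c * u i * (c * u j)"
    by (simp add: power2_eq_square algebra_simps)
qed (use assms in \<open>auto simp: log_concave_gap_def\<close>)

text \<open>
  Multiplication of a generating function by \<open>x + r\<close>. After expanding, the terms of the two sides can
  be compared one by one, except that the mixed term \<open>u (i - 1) * u j\<close> cancels and
  \<open>u (i - 2) * u (j + 1)\<close> is moved inwards by two steps (by one if \<open>i = j\<close>).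
\<close>

lemma log_concave_gap_linear_factor:
  assumes u: "log_concave_gap u" and r: "r \<ge> 0"
  shows "log_concave_gap (\<lambda>k. r * u k + u (k - 1))"
  unfolding log_concave_gap_def
proof (intro conjI allI impI)
  have nonneg: "u k \<ge> 0" for k using u by (auto simp: log_concave_gap_def)
  show "r * u k + u (k - 1) \<ge> 0" for k using nonneg r by simp
  have gap: "u (i - 1) * u (j + 1) \<le> u i * u j" if "i \<le> j" for i j
    using u that by (auto simp: log_concave_gap_def)
  fix i j :: int assume ij: "i \<le> j"
  have cross: "u (i - 2) * u (j + 1) \<le> u i * u (j - 1)"
  proof (cases "i = j")
    case True
    then show ?thesis using gap[of "i - 1" j] by (simp add: mult.commute)
  next
    case False
    then show ?thesis using gap[of "i - 1" j] gap[of i "j - 1"] ij by simp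
  qed
  have "r\<^sup>2 * (u (i - 1) * u (j + 1)) \<le> r\<^sup>2 * (u i * u j)"
    and "r * (u (i - 2) * u (j + 1)) \<le> r * (u i * u (j - 1))"
    and "u (i - 2) * u j \<le> u (i - 1) * u (j - 1)"
    using r gap[OF ij] cross gap[of "i - 1" "j - 1"] ij by (auto intro!: mult_left_mono)
  then show "(r * u (i - 1) + u (i - 1 - 1)) * (r * u (j + 1) + u (j + 1 - 1))
      \<le> (r * u i + u (i - 1)) * (r * u j + u (j - 1))"
    by (simp add: power2_eq_square algebra_simps)
qed

text \<open>
  At a position \<open>m\<close> of the maximum, comparing a pair that contains \<open>m\<close> with the pair one step further
  in and dividing by \<open>u m > 0\<close> shows that \<open>u\<close> increases up to \<open>m\<close> and decreases after it.
\<close>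

lemma log_concave_gap_imp_unimodal:
  assumes u: "log_concave_gap u" and fin: "finite {k. u k \<noteq> 0}"
  shows "unimodal u"
proof (cases "{k. u k \<noteq> 0} = {}")
  case True
  then show ?thesis by (auto simp: unimodal_def monotone_on_def)
next
  case False
  have nonneg: "u k \<ge> 0" for k using u by (auto simp: log_concave_gap_def)
  have gap: "u (i - 1) * u (j + 1) \<le> u i * u j" if "i \<le> j" for i j
    using u that by (auto simp: log_concave_gap_def)
  define K where "K = {k. u k \<noteq> 0}"
  have "Max (u ` K) \<in> u ` K" using fin False by (intro Max_in) (auto simp: K_def)
  then obtain m where m: "u m \<noteq> 0" and um: "u m = Max (u ` K)" by (auto simp: K_def)
  have max': "u k \<le> u m" if "u k \<noteq> 0" for k
    unfolding um using fin that by (intro Max_ge) (auto simp: K_def)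
  have pos: "u m > 0" using m nonneg[of m] by simp
  have max: "u k \<le> u m" for k using max'[of k] nonneg[of m] by (cases "u k = 0") auto
  have up: "u k \<le> u (k + 1)" if "k < m" for k
  proof -
    have "u k * u m \<le> u (k + 1) * u (m - 1)"
      using gap[of "k + 1" "m - 1"] that by (cases "k = m - 1") (simp_all add: mult.commute)
    also have "\<dots> \<le> u (k + 1) * u m" using max nonneg by (intro mult_left_mono) auto
    finally show ?thesis using pos by simp
  qed
  have down: "u (k + 1) \<le> u k" if "m \<le> k" for k
  proof -
    have "u m * u (k + 1) \<le> u (m + 1) * u k"
      using gap[of "m + 1" k] that by (cases "k = m") (simp_all add: mult.commute)
    also have "\<dots> \<le> u m * u k" using max nonneg by (intro mult_right_mono) auto
    finally show ?thesis using pos by simp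
  qed
  have "u i \<le> u j" if "i \<le> j" "j \<le> m" for i j
    using that
  proof (induction rule: int_ge_induct)
    case (step k)
    then show ?case using up[of k] by simp
  qed simp
  moreover have "u j \<le> u i" if "i \<le> j" "m \<le> i" for i j
    using that
  proof (induction rule: int_ge_induct)
    case (step k)
    then show ?case using down[of k] by simp
  qed simp
  ultimately show ?thesis
    unfolding unimodal_def monotone_on_def by (intro exI[of _ m]) auto
qed

lemma log_concave_gap_coeffs:
  assumes "finite R" "R \<subseteq> {0..}"
  shows "log_concave_gap (\<lambda>k. if k < 0 then 0 else coeff (\<Prod>r\<in>R. [:r, 1:]) (nat k))"
  using assms
proof (induction rule: finite_induct)
  case empty
  then show ?case by (auto simp: log_concave_gap_def)
next
  case (insert r R)
  define q where "q = (\<Prod>r\<in>R. [:r, 1::real:])"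
  let ?u = "\<lambda>k::int. if k < 0 then 0 else coeff q (nat k)"
  have "log_concave_gap (\<lambda>k. r * ?u k + ?u (k - 1))"
    using insert unfolding q_def by (intro log_concave_gap_linear_factor) simp_all
  also have "(\<lambda>k. r * ?u k + ?u (k - 1))
      = (\<lambda>k. if k < 0 then 0 else coeff (\<Prod>r\<in>insert r R. [:r, 1:]) (nat k))"
  proof
    fix k :: int
    show "r * ?u k + ?u (k - 1) =
        (if k < 0 then 0 else coeff (\<Prod>r\<in>insert r R. [:r, 1:]) (nat k))"
      using insert.hyps
      by (cases "nat k") (auto simp: coeff_pCons nat_diff_distrib simp flip: q_def split: nat.split)
  qed
  finally show ?case .
qed


section \<open>Interlacing of roots\<close>

text \<open>
  Up to a positive factor the product is the derivative at the root \<open>r i\<close> of the polynomial with roots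
  \<open>r 0 < \<dots> < r (n - 1)\<close>; each larger root contributes a sign.
\<close>

lemma sign_prod_differences:
  fixes r :: "nat \<Rightarrow> real"
  assumes mono: "\<And>i j. i < j \<Longrightarrow> j < n \<Longrightarrow> r i < r j" and i: "i < n"
  shows "(-1) ^ (n - 1 - i) * (\<Prod>j\<in>{..<n} - {i}. r i - r j) > 0"
proof -
  have split: "{..<n} - {i} = {..<i} \<union> {Suc i..<n}" using i by auto
  have "(\<Prod>j\<in>{Suc i..<n}. r i - r j) = (-1) ^ (n - 1 - i) * (\<Prod>j\<in>{Suc i..<n}. r j - r i)"
    using prod_uminus[of "\<lambda>j. r j - r i" "{Suc i..<n}"] by simp
  then have "(-1) ^ (n - 1 - i) * (\<Prod>j\<in>{..<n} - {i}. r i - r j)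
      = (\<Prod>j\<in>{..<i}. r i - r j) * (\<Prod>j\<in>{Suc i..<n}. r j - r i)"
    unfolding split by (subst prod.union_disjoint) (auto simp flip: power_add)
  also have "\<dots> > 0" using mono i by (intro mult_pos_pos prod_pos) auto
  finally show ?thesis .
qed

lemma alternating_signs_imp_roots:
  fixes p :: "real poly" and t :: "nat \<Rightarrow> real"
  assumes mono: "\<And>i. i < m \<Longrightarrow> t i < t (Suc i)"
    and sign: "\<And>i. i \<le> m \<Longrightarrow> (-1) ^ (m - i) * poly p (t i) > 0"
  obtains s where "\<And>i. i < m \<Longrightarrow> t i < s i \<and> s i < t (Suc i) \<and> poly p (s i) = 0"
proof -
  have "\<exists>x. t i < x \<and> x < t (Suc i) \<and> poly p x = 0" if "i < m" for i
  proof -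
    have "m - i = Suc (m - Suc i)" using that by simp
    then have "((-1) ^ (m - Suc i) * poly p (t i)) * ((-1) ^ (m - Suc i) * poly p (t (Suc i))) < 0"
      using sign[of i] sign[of "Suc i"] that by (simp add: mult_neg_pos)
    then have "poly p (t i) * poly p (t (Suc i)) < 0"
      by (cases "even (m - Suc i)") simp_all
    then show ?thesis using poly_IVT[OF mono[OF that]] by blast
  qed
  then show ?thesis using that by metis
qed

lemma poly_sign_at_minus_infinity:
  fixes p :: "real poly"
  assumes "lead_coeff p > 0"
  obtains x where "x < y" "(-1) ^ degree p * poly p x > 0"
proof -
  let ?q = "smult ((-1) ^ degree p) (pcompose p [:0, -1:])"
  have "lead_coeff ?q = lead_coeff p"
    by (simp add: lead_coeff_comp flip: power_mult_distrib)
  then obtain N where N: "\<forall>x\<ge>N. poly ?q x \<ge> lead_coeff p"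
    using poly_pinfty_gt_lc[of ?q] assms by metis
  have "poly ?q (max N (1 - y)) \<ge> lead_coeff p" using N by simp
  with assms that[of "- max N (1 - y)"] show ?thesis by (simp add: poly_pcompose)
qed

lemma poly_eq_prod_roots:
  fixes p :: "real poly"
  assumes "finite A" "card A = degree p" "\<And>x. x \<in> A \<Longrightarrow> poly p x = 0" "p \<noteq> 0"
  shows "p = smult (lead_coeff p) (\<Prod>x\<in>A. [:-x, 1:])"
  using assms
proof (induction A arbitrary: p rule: finite_induct)
  case empty
  then show ?case by (auto elim!: degree_eq_zeroE)
next
  case (insert x A)
  then obtain q where q: "p = [:-x, 1:] * q" by (metis poly_eq_0_iff_dvd insertI1 dvdE)
  with insert.prems have "q \<noteq> 0" by auto
  then have deg: "degree p = Suc (degree q)" unfolding q by (subst degree_mult_eq) auto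
  have "q = smult (lead_coeff q) (\<Prod>x\<in>A. [:-x, 1:])"
  proof (rule insert.IH)
    show "card A = degree q" using insert.hyps insert.prems(1) deg by simp
    fix y assume "y \<in> A"
    then have "y \<noteq> x" "poly p y = 0" using insert by auto
    then show "poly q y = 0" unfolding q by simp
  qed fact
  moreover have "lead_coeff q = lead_coeff p" unfolding q lead_coeff_mult by simp
  ultimately have "p = [:-x, 1:] * smult (lead_coeff p) (\<Prod>x\<in>A. [:-x, 1:])" using q by metis
  then show ?case using insert.hyps by simp
qed

text \<open>
  At a root \<open>r j\<close> of \<open>P\<close> the recursion leaves \<open>Q (r j) = r j * (1 - r j) * P' (r j)\<close>, and these values
  alternate in sign because those of \<open>P'\<close> do. Together with \<open>Q 0 = a * P 0 > 0\<close> on the right, and on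
  the left a point where the leading coefficient \<open>b * c > 0\<close> determines the sign, this gives
  \<open>n + 2\<close> points of \<open>(-\<infinity>, 0]\<close> with alternating signs, hence \<open>n + 1 = degree Q\<close> negative roots.
\<close>

lemma euler_poly_step_roots:
  fixes r :: "nat \<Rightarrow> real"
  assumes "a > 0" "b > 0" "c > 0" 
    and mono: "\<And>i j. i < j \<Longrightarrow> j < n \<Longrightarrow> r i < r j" and neg: "\<And>i. i < n \<Longrightarrow> r i < 0"
    and P: "P = smult c (\<Prod>i<n. [:- r i, 1:])"
    and Q: "Q = [:a, real n + b:] * P + [:0, 1, -1:] * pderiv P"
  shows "\<exists>c' s. c' > 0 \<and> (\<forall>i j. i < j \<longrightarrow> j < Suc n \<longrightarrow> s i < s j) \<and> (\<forall>i<Suc n. s i < 0) \<and>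
     Q = smult c' (\<Prod>i<Suc n. [:- s i, 1::real:])"
proof -
  have degP: "degree P = n"
    using \<open>c > 0\<close> unfolding P by (simp add: degree_prod_eq_sum_degree)
  have lcP: "lead_coeff P = c"
    unfolding P lead_coeff_smult lead_coeff_prod by simp
  \<comment> \<open>the \<open>x\<^sup>n\<^sup>+\<^sup>1\<close> terms \<open>n c\<close> of the two summands cancel, and \<open>b * c\<close> remains\<close>
  have "coeff Q (Suc n) = (real n + b) * coeff P n + a * coeff P (Suc n)
     + coeff (pderiv P) n - (if n = 0 then 0 else coeff (pderiv P) (n - 1))"
    unfolding Q by (cases n) (simp_all)
  also have "\<dots> = b * c"
    using lcP degP by (cases n) (simp_all add: coeff_pderiv coeff_eq_0 algebra_simps)
  finally have lcQ: "coeff Q (Suc n) = b * c" .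
  have "degree Q \<le> Suc n"
  proof (rule degree_le, intro allI impI)
    fix i assume "Suc n < i"
    then obtain j where "i = Suc (Suc j)" "n < Suc j" by (cases i; cases "i - 1") auto
    then show "coeff Q i = 0" unfolding Q using degP by (simp add: coeff_pderiv coeff_eq_0)
  qed
  with lcQ assms have degQ: "degree Q = Suc n"
    by (metis le_antisym le_degree mult_pos_pos less_irrefl)
  obtain t0 where t0: "t0 < (if n = 0 then 0 else r 0)" "(-1) ^ Suc n * poly Q t0 > 0"
    using poly_sign_at_minus_infinity[of Q] lcQ degQ assms by (metis mult_pos_pos)
  \<comment> \<open>the \<open>n + 2\<close> test points: \<open>t0\<close>, the roots of \<open>P\<close>, and \<open>0\<close>\<close>
  define t where "t i = (if i = 0 then t0 else if i = Suc n then 0 else r (i - 1))" for i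
  have sign: "(-1) ^ (Suc n - i) * poly Q (t i) > 0" if "i \<le> Suc n" for i
  proof -
    consider "i = 0" | "i = Suc n" | j where "i = Suc j" "j < n" using \<open>i \<le> Suc n\<close> by (cases i) (auto simp: le_less)
    then show ?thesis
    proof cases
      case 1
      then show ?thesis using t0 by (simp add: t_def)
    next
      case 2
      have "poly P 0 = c * (\<Prod>i<n. - r i)" unfolding P by (simp add: poly_prod)
      also have "\<dots> > 0" using neg assms by (intro mult_pos_pos prod_pos) auto
      finally have "poly P 0 > 0" .
      then show ?thesis using 2 \<open>a > 0\<close> by (simp add: t_def Q)
    next
      case 3
      have root: "poly P (r j) = 0" unfolding P using 3 by (auto simp: poly_prod)
      have "poly (pderiv P) (r j) =
          c * (\<Sum>i<n. (\<Prod>k\<in>{..<n} - {i}. r j - r k))"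
        unfolding P pderiv_smult pderiv_prod by (simp add: poly_sum poly_prod pderiv_pCons)
      also have "(\<Sum>i<n. (\<Prod>k\<in>{..<n} - {i}. r j - r k)) = (\<Sum>i\<in>{j}. (\<Prod>k\<in>{..<n} - {i}. r j - r k))"
        using 3 by (intro sum.mono_neutral_right) auto
      finally have D: "poly (pderiv P) (r j) = c * (\<Prod>k\<in>{..<n} - {j}. r j - r k)" by simp
      have "n - j = Suc (n - 1 - j)" using 3 by simp
      then have "(-1) ^ (n - j) * poly Q (r j) =
          (c * (- r j) * (1 - r j)) * ((-1) ^ (n - 1 - j) * (\<Prod>k\<in>{..<n} - {j}. r j - r k))"
        unfolding Q by (simp add: root D algebra_simps)
      also have "\<dots> > 0"
      proof (rule mult_pos_pos)
        have "r j < 0" using neg 3 by blast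
        with \<open>c > 0\<close> show "c * (- r j) * (1 - r j) > 0" by (intro mult_pos_pos) auto
        show "(-1) ^ (n - 1 - j) * (\<Prod>k\<in>{..<n} - {j}. r j - r k) > 0"
          by (rule sign_prod_differences) (use mono 3 in auto)
      qed
      finally show ?thesis using 3 by (simp add: t_def)
    qed
  qed
  have tmono: "t i < t (Suc i)" if "i < Suc n" for i
    using that t0 neg mono[of "i - 1" i] by (auto simp: t_def split: if_splits)
  obtain s where s: "\<And>i. i < Suc n \<Longrightarrow> t i < s i \<and> s i < t (Suc i) \<and> poly Q (s i) = 0"
    using alternating_signs_imp_roots[of "Suc n" t Q] tmono sign by metis
  have smono: "s i < s j" if "i < j" "j < Suc n" for i j
  proof -
    have "t (Suc i) \<le> t j"
      using Suc_leI[OF that(1)] that(2)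
    proof (induction j rule: dec_induct)
      case (step k)
      then show ?case using tmono[of k] by simp
    qed simp
    then show ?thesis using s[of i] s[of j] that by linarith
  qed
  have sneg: "s i < 0" if "i < Suc n" for i
    using smono[of i n] s[of n] that by (cases "i = n") (auto simp: t_def)
  have inj: "inj_on s {..<Suc n}"
    by (rule linorder_inj_onI) (use smono in force)+
  have "Q = smult (lead_coeff Q) (\<Prod>x\<in>s ` {..<Suc n}. [:-x, 1:])"
    using s lcQ degQ assms inj by (intro poly_eq_prod_roots) (auto simp: card_image)
  also have "\<dots> = smult (b * c) (\<Prod>i<Suc n. [:- s i, 1:])"
    using inj degQ lcQ by (simp add: prod.reindex)
  finally show ?thesis using smono sneg assms by (metis mult_pos_pos)
qed

lemma euler_poly_factorization:
  assumes "a > 0" "b > 0"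
  obtains c R where "c > 0" "finite R" "card R = n" "R \<subseteq> {0<..}"
    "euler_poly a b n = smult c (\<Prod>r\<in>R. [:r, 1:])"
proof -
  have "\<exists>c r. c > 0 \<and> (\<forall>i j. i < j \<longrightarrow> j < n \<longrightarrow> r i < r j) \<and> (\<forall>i<n. r i < 0) \<and>
     euler_poly a b n = smult c (\<Prod>i<n. [:- r i, 1:])"
  proof (induction n)
    case 0
    then show ?case by (intro exI[of _ 1]) (auto simp: one_pCons)
  next
    case (Suc n)
    then obtain c r where "c > 0" "\<And>i j. i < j \<Longrightarrow> j < n \<Longrightarrow> r i < r j"
      "\<And>i. i < n \<Longrightarrow> r i < 0" "euler_poly a b n = smult c (\<Prod>i<n. [:- r i, 1:])"
      by blast
    from euler_poly_step_roots[OF assms this euler_poly.simps(2)] show ?case .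
  qed
  then obtain c r where r: "c > 0" "\<And>i j. i < j \<Longrightarrow> j < n \<Longrightarrow> r i < r j" "\<And>i. i < n \<Longrightarrow> r i < 0"
    and P: "euler_poly a b n = smult c (\<Prod>i<n. [:- r i, 1:])"
    by blast
  have inj: "inj_on (\<lambda>i. - r i) {..<n}"
    by (rule linorder_inj_onI) (use r(2) in force)+
  show ?thesis
  proof
    show "c > 0" by fact
    show "card ((\<lambda>i. - r i) ` {..<n}) = n" using inj by (simp add: card_image)
    show "euler_poly a b n = smult c (\<Prod>r\<in>(\<lambda>i. - r i) ` {..<n}. [:r, 1:])"
      using P inj by (simp add: prod.reindex)
  qed (use r(3) in auto)
qed


section \<open>Adding a column to a staircase tableau\<close>

lemma tableauxD:
  assumes S: "S \<in> tableaux n"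
  shows "S (i, j) \<noteq> None \<Longrightarrow> 1 \<le> i \<and> 1 \<le> j \<and> i + j \<le> n + 1"
    and "1 \<le> i \<Longrightarrow> 1 \<le> j \<Longrightarrow> i + j = n + 1 \<Longrightarrow> S (i, j) \<noteq> None"
    and "S (i, j) = Some Beta \<Longrightarrow> j' < j \<Longrightarrow> S (i, j') = None"
    and "S (i, j) = Some Alpha \<Longrightarrow> i' < i \<Longrightarrow> S (i', j) = None"
proof -
  have box: "(i, j) \<in> boxes n" if "S (i, j) \<noteq> None"
  proof (rule ccontr)
    assume "(i, j) \<notin> boxes n"
    moreover have "\<forall>p. p \<notin> boxes n \<longrightarrow> S p = None"
      using S unfolding tableaux_def by (elim CollectE conjE)
    ultimately show False using that by simp
  qed
  then show "S (i, j) \<noteq> None \<Longrightarrow> 1 \<le> i \<and> 1 \<le> j \<and> i + j \<le> n + 1"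
    by (simp add: boxes_def)
  note * = S[unfolded tableaux_def mem_Collect_eq, THEN conjunct2]
  show "S (i, j) \<noteq> None" if "1 \<le> i" "1 \<le> j" "i + j = n + 1"
    using bspec[OF *[THEN conjunct1], of "(i, j)"] that by (simp add: boxes_def)
  show "S (i, j') = None" if "S (i, j) = Some Beta" "j' < j"
    using bspec[OF *[THEN conjunct2, THEN conjunct1] box] that by simp
  show "S (i', j) = None" if "S (i, j) = Some Alpha" "i' < i"
    using bspec[OF *[THEN conjunct2, THEN conjunct2] box] that by simp
qed

lemma tableaux_outside:
  assumes "S \<in> tableaux n" "i < 1 \<or> j < 1 \<or> i + j > n + 1"
  shows "S (i, j) = None"
proof (rule ccontr)
  assume "S (i, j) \<noteq> None"
  from tableauxD(1)[OF assms(1) this] assms(2) show False by linarith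
qed

text \<open>
  Since fillings are empty outside the diagram, the conditions on rows and columns may be stated for
  all positions.
\<close>

lemma tableauxI:
  assumes inside: "\<And>i j. S (i, j) \<noteq> None \<Longrightarrow> 1 \<le> i \<and> 1 \<le> j \<and> i + j \<le> n + 1"
    and diag: "\<And>i j. 1 \<le> i \<Longrightarrow> 1 \<le> j \<Longrightarrow> i + j = n + 1 \<Longrightarrow> S (i, j) \<noteq> None"
    and row: "\<And>i j j'. S (i, j) = Some Beta \<Longrightarrow> j' < j \<Longrightarrow> S (i, j') = None"
    and col: "\<And>i j i'. S (i, j) = Some Alpha \<Longrightarrow> i' < i \<Longrightarrow> S (i', j) = None"
  shows "S \<in> tableaux n"
  unfolding tableaux_def
proof (intro CollectI conjI)
  show "\<forall>p. p \<notin> boxes n \<longrightarrow> S p = None"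
  proof (intro allI impI)
    fix p assume p: "p \<notin> boxes n"
    obtain i j where ij: "p = (i, j)" by (cases p)
    show "S p = None"
    proof (rule ccontr)
      assume "S p \<noteq> None"
      with inside[of i j] p show False by (simp add: ij boxes_def)
    qed
  qed
  show "\<forall>(i, j)\<in>boxes n. i + j = n + 1 \<longrightarrow> S (i, j) \<noteq> None"
    using diag by (simp add: boxes_def split_def)
  show "\<forall>(i, j)\<in>boxes n. S (i, j) = Some Beta \<longrightarrow> (\<forall>j'<j. S (i, j') = None)"
    using row by (simp add: split_def)
  show "\<forall>(i, j)\<in>boxes n. S (i, j) = Some Alpha \<longrightarrow> (\<forall>i'<i. S (i', j) = None)"
    using col by (simp add: split_def)
qed

text \<open>
  A row admits a symbol in a new leftmost box iff it contains no \<open>\<beta>\<close>, because a \<open>\<beta>\<close> forces all boxes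
  on its left to be empty.
\<close>

definition free_rows :: "nat \<Rightarrow> filling \<Rightarrow> nat set" where
  "free_rows n S = {i \<in> {1..n}. \<forall>j. S (i, j) \<noteq> Some Beta}"

definition column_fillings :: "nat set \<Rightarrow> (nat \<Rightarrow> symbol option) set" where
  "column_fillings F = {c. (\<forall>i. c i \<noteq> None \<longrightarrow> i \<in> F) \<and>
                   (\<forall>i. c i = Some Alpha \<longrightarrow> (\<forall>i'<i. c i' = None))}"

definition attach_column :: "filling \<Rightarrow> (nat \<Rightarrow> symbol option) \<Rightarrow> filling" where
  "attach_column S c = (\<lambda>(i, j). if j = 0 then None else if j = 1 then c i else S (i, j - 1))"

lemma column_fillings_I:
  assumes "\<And>i. c i \<noteq> None \<Longrightarrow> i \<in> F"
    and "\<And>i i'. c i = Some Alpha \<Longrightarrow> i' < i \<Longrightarrow> c i' = None"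
  shows "c \<in> column_fillings F"
  unfolding column_fillings_def by (intro CollectI conjI allI impI assms)

lemma column_fillings_D:
  assumes "c \<in> column_fillings F"
  shows "c i \<noteq> None \<Longrightarrow> i \<in> F"
    and "c i = Some Alpha \<Longrightarrow> i' < i \<Longrightarrow> c i' = None"
  by (rule assms[unfolded column_fillings_def mem_Collect_eq, THEN conjunct1, rule_format];
      assumption)
    (rule assms[unfolded column_fillings_def mem_Collect_eq, THEN conjunct2, rule_format];
      assumption)

lemma column_filling_eq_None: "c \<in> column_fillings F \<Longrightarrow> i \<notin> F \<Longrightarrow> c i = None"
  by (rule ccontr) (drule column_fillings_D(1), auto)

lemma column_fillings_empty: "column_fillings {} = {\<lambda>_. None}"
proof (intro equalityI subsetI)
  fix c :: "nat \<Rightarrow> symbol option" assume "c \<in> column_fillings {}"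
  then have "c = (\<lambda>_. None)" by (intro ext column_filling_eq_None[of c "{}"]) auto
  then show "c \<in> {\<lambda>_. None}" by simp
qed (auto intro: column_fillings_I)

text \<open>
  The lowest box decides: if it is empty or \<open>\<beta>\<close>, every filling of the rows above is possible; if
  it is \<open>\<alpha>\<close>, they are empty.
\<close>

lemma column_fillings_insert_max:
  assumes less: "\<forall>i\<in>F. i < m"
  shows "column_fillings (insert m F) = column_fillings F \<union> (\<lambda>c. c(m := Some Beta)) ` column_fillings F
           \<union> {\<lambda>i. if i = m then Some Alpha else None}" (is "_ = ?A \<union> ?B \<union> {?c}")
proof (intro equalityI subsetI)
  fix c assume c: "c \<in> column_fillings (insert m F)"
  consider "c m = None" | "c m = Some Beta" | "c m = Some Alpha"
    by (metis option.exhaust symbol.exhaust)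
  then show "c \<in> ?A \<union> ?B \<union> {?c}"
  proof cases
    case 1
    have "c \<in> ?A"
    proof (rule column_fillings_I)
      show "i \<in> F" if "c i \<noteq> None" for i
        using column_fillings_D(1)[OF c that] that 1 by auto
    next
      show "c i' = None" if "c i = Some Alpha" "i' < i" for i i'
        using that by (rule column_fillings_D(2)[OF c])
    qed
    then show ?thesis by simp
  next
    case 2
    have "c(m := None) \<in> ?A"
    proof (rule column_fillings_I)
      fix i assume "(c(m := None)) i \<noteq> None"
      then show "i \<in> F" using column_fillings_D(1)[OF c, of i] by (cases "i = m") auto
    next
      fix i i' assume "(c(m := None)) i = Some Alpha" "i' < i"
      then show "(c(m := None)) i' = None"
        using column_fillings_D(2)[OF c, of i i'] by (cases "i = m") auto
    qed
    moreover have "c = (c(m := None))(m := Some Beta)" using 2 by auto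
    ultimately show ?thesis by (metis UnI1 UnI2 image_eqI)
  next
    case 3
    have "c i = None" if "i \<noteq> m" for i
    proof (cases "i < m")
      case True
      then show ?thesis by (rule column_fillings_D(2)[OF c 3])
    next
      case False
      then have "i \<notin> insert m F" using that less by auto
      then show ?thesis using column_fillings_D(1)[OF c, of i] by blast
    qed
    with 3 have "c = ?c" by auto
    then show ?thesis by simp
  qed
next
  fix c assume "c \<in> ?A \<union> ?B \<union> {?c}"
  then consider "c \<in> ?A" | d where "d \<in> ?A" "c = d(m := Some Beta)" | "c = ?c" by auto
  then show "c \<in> column_fillings (insert m F)"
  proof cases
    case 1
    show ?thesis
    proof (rule column_fillings_I)
      show "i \<in> insert m F" if "c i \<noteq> None" for i
        using column_fillings_D(1)[OF 1 that] by simp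
    next
      show "c i' = None" if "c i = Some Alpha" "i' < i" for i i'
        using that by (rule column_fillings_D(2)[OF 1])
    qed
  next
    case 2
    show ?thesis
    proof (rule column_fillings_I)
      fix i assume "c i \<noteq> None"
      then show "i \<in> insert m F" using column_fillings_D(1)[OF 2(1), of i] 2(2) by (cases "i = m") auto
    next
      fix i i' assume i: "c i = Some Alpha" "i' < i"
      then have "d i = Some Alpha" using 2(2) by (cases "i = m") auto
      moreover from this have "i < m" using column_fillings_D(1)[OF 2(1), of i] less by auto
      ultimately show "c i' = None" using column_fillings_D(2)[OF 2(1), of i i'] i(2) 2(2) by simp
    qed
  next
    case 3
    show ?thesis by (rule column_fillings_I) (auto simp: 3 split: if_splits)
  qed
qed

lemma finite_column_fillings: "finite F \<Longrightarrow> finite (column_fillings F)"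
proof (induction F rule: finite_linorder_max_induct)
  case empty
  show ?case by (simp add: column_fillings_empty)
next
  case (insert m F)
  then show ?case by (subst column_fillings_insert_max) auto
qed

lemma sum_column_fillings_insert_max:
  fixes f :: "(nat \<Rightarrow> symbol option) \<Rightarrow> real"
  assumes "finite F" and less: "\<forall>i\<in>F. i < m"
  shows "(\<Sum>c\<in>column_fillings (insert m F). f c) =
     (\<Sum>c\<in>column_fillings F. f c) + (\<Sum>c\<in>column_fillings F. f (c(m := Some Beta)))
       + f (\<lambda>i. if i = m then Some Alpha else None)"
proof -
  have none: "c m = None" if "c \<in> column_fillings F" for c
    by (rule column_filling_eq_None[OF that]) (use less in auto)
  have inj: "inj_on (\<lambda>c. c(m := Some Beta)) (column_fillings F)"
  proof (rule inj_onI)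
    fix c d assume cd: "c \<in> column_fillings F" "d \<in> column_fillings F" "c(m := Some Beta) = d(m := Some Beta)"
    show "c = d"
    proof
      fix i show "c i = d i"
      proof (cases "i = m")
        case True
        then show ?thesis using none[OF cd(1)] none[OF cd(2)] by simp
      next
        case False
        then show ?thesis using fun_cong[OF cd(3), of i] by simp
      qed
    qed
  qed
  define A B where "A = column_fillings F" and "B = (\<lambda>c. c(m := Some Beta)) ` column_fillings F"
  define c0 where "c0 = (\<lambda>i. if i = m then Some Alpha else None)"
  have finA: "finite A" and finB: "finite B"
    using finite_column_fillings[OF assms(1)] by (simp_all add: A_def B_def)
  have A: "c m = None" if "c \<in> A" for c using none that by (simp add: A_def)
  have B: "c m = Some Beta" if "c \<in> B" for c
    using that unfolding B_def by (elim imageE) simp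
  have "c0 m = Some Alpha" by (simp add: c0_def)
  then have c0: "c0 \<notin> A \<union> B" using A[of c0] B[of c0] by auto
  have disj: "A \<inter> B = {}"
  proof (rule equals0I)
    fix c assume "c \<in> A \<inter> B"
    then show False using A[of c] B[of c] by simp
  qed
  have "column_fillings (insert m F) = insert c0 (A \<union> B)"
    unfolding column_fillings_insert_max[OF less] A_def B_def c0_def by (simp only: Un_insert_right Un_empty_right)
  then have "(\<Sum>c\<in>column_fillings (insert m F). f c) = f c0 + sum f (A \<union> B)"
    using sum.insert[OF finite_UnI[OF finA finB] c0, of f] by (simp only:)
  also have "sum f (A \<union> B) = sum f A + sum f B"
    by (rule sum.union_disjoint[OF finA finB disj])
  also have "sum f B = (\<Sum>c\<in>column_fillings F. f (c(m := Some Beta)))"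
    unfolding B_def by (simp only: sum.reindex[OF inj] comp_def)
  finally show ?thesis by (simp only: A_def c0_def add.commute)
qed

primrec entry_weight :: "real \<Rightarrow> real \<Rightarrow> real \<Rightarrow> symbol \<Rightarrow> real" where
  "entry_weight \<alpha> \<beta> y Alpha = \<alpha> * y"
| "entry_weight \<alpha> \<beta> y Beta = \<beta>"

text \<open>
  The variable \<open>y\<close> marks the rows that are still without \<open>\<beta>\<close> after the column has been filled. An empty
  box or an \<open>\<alpha>\<close> keeps its row free and so carries a factor \<open>y\<close>, while a \<open>\<beta>\<close> does not.
\<close>

definition column_weight :: "real \<Rightarrow> real \<Rightarrow> real \<Rightarrow> nat set \<Rightarrow> (nat \<Rightarrow> symbol option) \<Rightarrow> real" where
  "column_weight \<alpha> \<beta> y F c = (\<Prod>i\<in>F. case c i of None \<Rightarrow> y | Some s \<Rightarrow> entry_weight \<alpha> \<beta> y s)"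

lemma column_weight_insert:
  assumes "finite F" "\<forall>i\<in>F. i < m"
  shows "column_weight \<alpha> \<beta> y (insert m F) c =
     (case c m of None \<Rightarrow> y | Some s \<Rightarrow> entry_weight \<alpha> \<beta> y s) * column_weight \<alpha> \<beta> y F c"
    and "column_weight \<alpha> \<beta> y F (c(m := s)) = column_weight \<alpha> \<beta> y F c"
    and "column_weight \<alpha> \<beta> y F (\<lambda>i. if i = m then Some Alpha else None) = y ^ card F"
proof -
  have "m \<notin> F" using assms by auto
  then show "column_weight \<alpha> \<beta> y (insert m F) c =
     (case c m of None \<Rightarrow> y | Some s \<Rightarrow> entry_weight \<alpha> \<beta> y s) * column_weight \<alpha> \<beta> y F c"
    using assms by (simp add: column_weight_def)
  show "column_weight \<alpha> \<beta> y F (c(m := s)) = column_weight \<alpha> \<beta> y F c"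
    using \<open>m \<notin> F\<close> unfolding column_weight_def by (intro prod.cong) auto
  have "column_weight \<alpha> \<beta> y F (\<lambda>i. if i = m then Some Alpha else None) = (\<Prod>i\<in>F. y)"
    using \<open>m \<notin> F\<close> unfolding column_weight_def by (intro prod.cong) auto
  then show "column_weight \<alpha> \<beta> y F (\<lambda>i. if i = m then Some Alpha else None) = y ^ card F" by simp
qed

text \<open>
  The factor \<open>\<beta>\<close> avoids the division in the geometric sum over the position of the \<open>\<alpha>\<close> in the column.
\<close>

lemma sum_column_weight:
  assumes "finite F"
  shows "\<beta> * (\<Sum>c\<in>column_fillings F. column_weight \<alpha> \<beta> y F c)
           = (\<beta> + \<alpha> * y) * (y + \<beta>) ^ card F - \<alpha> * y * y ^ card F"
  using assms
proof (induction F rule: finite_linorder_max_induct)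
  case empty
  show ?case by (simp add: column_weight_def column_fillings_empty)
next
  case (insert m F)
  let ?W = "\<Sum>c\<in>column_fillings F. column_weight \<alpha> \<beta> y F c"
  have m: "m \<notin> F" using insert by auto
  note w = column_weight_insert[OF insert.hyps(1,2)]
  have "(\<Sum>c\<in>column_fillings (insert m F). column_weight \<alpha> \<beta> y (insert m F) c) =
      (\<Sum>c\<in>column_fillings F. y * column_weight \<alpha> \<beta> y F c) + (\<Sum>c\<in>column_fillings F. \<beta> * column_weight \<alpha> \<beta> y F c)
       + \<alpha> * y * y ^ card F"
    unfolding sum_column_fillings_insert_max[OF insert.hyps(1,2)]
    by (intro arg_cong2[where f = "(+)"] sum.cong) (auto simp: w column_filling_eq_None[OF _ m])
  also have "\<dots> = (y + \<beta>) * ?W + \<alpha> * y * y ^ card F"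
    by (simp add: distrib_right flip: sum_distrib_left)
  finally have "\<beta> * (\<Sum>c\<in>column_fillings (insert m F). column_weight \<alpha> \<beta> y (insert m F) c) =
      (y + \<beta>) * (\<beta> * ?W) + \<beta> * (\<alpha> * y * y ^ card F)"
    by (simp add: algebra_simps)
  then show ?case
    using m insert.hyps(1) unfolding insert.IH by (simp add: algebra_simps)
qed

text \<open>
  The box in row \<open>m\<close> is the diagonal one: it must not be empty, and \<open>x\<close> marks an \<open>\<alpha>\<close> in it.
\<close>

lemma sum_column_weight_nonempty_bottom:
  assumes "finite F" "\<forall>i\<in>F. i < m"
  shows "(\<Sum>c\<in>{c \<in> column_fillings (insert m F). c m \<noteq> None}.
            (if c m = Some Alpha then x else 1) * column_weight \<alpha> \<beta> y (insert m F) c)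
         = (\<beta> + \<alpha> * y) * (y + \<beta>) ^ card F + \<alpha> * y * (x - 1) * y ^ card F"
proof -
  have m: "m \<notin> F" using assms by auto
  note w = column_weight_insert[OF assms]
  let ?g = "\<lambda>c. (if c m = Some Alpha then x else 1) * column_weight \<alpha> \<beta> y (insert m F) c"
  have "(\<Sum>c\<in>{c \<in> column_fillings (insert m F). c m \<noteq> None}. ?g c)
      = (\<Sum>c\<in>column_fillings (insert m F). if c m \<noteq> None then ?g c else 0)"
    using assms by (simp add: sum.inter_filter finite_column_fillings)
  also have "\<dots> = (\<Sum>c\<in>column_fillings F. 0) + (\<Sum>c\<in>column_fillings F. \<beta> * column_weight \<alpha> \<beta> y F c)
       + x * (\<alpha> * y * y ^ card F)"
    unfolding sum_column_fillings_insert_max[OF assms]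
    by (intro arg_cong2[where f = "(+)"] sum.cong) (auto simp: w column_filling_eq_None[OF _ m])
  also have "\<dots> = \<beta> * (\<Sum>c\<in>column_fillings F. column_weight \<alpha> \<beta> y F c) + x * (\<alpha> * y * y ^ card F)"
    by (simp add: sum_distrib_left)
  finally show ?thesis
    unfolding sum_column_weight[OF assms(1)] by (simp add: algebra_simps)
qed

lemma prod_if_eq_power_card:
  "finite F \<Longrightarrow> (\<Prod>i\<in>F. if P i then z else 1) = z ^ card {i \<in> F. P i}" for z :: real
  by (subst prod.inter_filter[symmetric]) simp_all

lemma column_weight_eq_powers:
  assumes "finite F" "c \<in> column_fillings F"
  shows "column_weight \<alpha> \<beta> y F c =
     \<alpha> ^ card {i. c i = Some Alpha} * \<beta> ^ card {i. c i = Some Beta} * y ^ card {i \<in> F. c i \<noteq> Some Beta}"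
proof -
  have "column_weight \<alpha> \<beta> y F c = (\<Prod>i\<in>F. (if c i = Some Alpha then \<alpha> else 1) *
      (if c i = Some Beta then \<beta> else 1) * (if c i \<noteq> Some Beta then y else 1))"
    unfolding column_weight_def
  proof (intro prod.cong refl)
    fix i
    show "(case c i of None \<Rightarrow> y | Some s \<Rightarrow> entry_weight \<alpha> \<beta> y s) =
       (if c i = Some Alpha then \<alpha> else 1) *
      (if c i = Some Beta then \<beta> else 1) * (if c i \<noteq> Some Beta then y else 1)"
      by (cases "c i"; cases "the (c i)") auto
  qed
  moreover have "{i. c i = Some Alpha} = {i \<in> F. c i = Some Alpha}"
    "{i. c i = Some Beta} = {i \<in> F. c i = Some Beta}"
    using column_filling_eq_None[OF assms(2)] by (metis (lifting) option.distinct(1))+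
  ultimately show ?thesis
    using assms(1) by (simp only: prod.distrib prod_if_eq_power_card)
qed

definition detach_column :: "filling \<Rightarrow> filling" where
  "detach_column T = (\<lambda>(i, j). if j = 0 then None else T (i, Suc j))"

lemma attach_column_simps [simp]:
  "attach_column S c (i, 0) = None"
  "attach_column S c (i, Suc 0) = c i"
  "attach_column S c (i, Suc (Suc j)) = S (i, Suc j)"
  by (simp_all add: attach_column_def)

lemma detach_column_simps [simp]:
  "detach_column T (i, 0) = None"
  "detach_column T (i, Suc j) = T (i, Suc (Suc j))"
  by (simp_all add: detach_column_def)

lemma detach_attach_column:
  assumes "S \<in> tableaux n"
  shows "detach_column (attach_column S c) = S"
proof
  fix p :: "nat \<times> nat"
  obtain i j where p: "p = (i, j)" by (cases p)
  show "detach_column (attach_column S c) p = S p"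
    unfolding p using tableaux_outside[OF assms, of i 0] by (cases j) simp_all
qed

lemma attach_detach_column:
  assumes "T \<in> tableaux n"
  shows "attach_column (detach_column T) (\<lambda>i. T (i, Suc 0)) = T"
proof
  fix p :: "nat \<times> nat"
  obtain i j where p: "p = (i, j)" by (cases p)
  consider "j = 0" | "j = Suc 0" | k where "j = Suc (Suc k)" by (metis not0_implies_Suc)
  then show "attach_column (detach_column T) (\<lambda>i. T (i, Suc 0)) p = T p"
    unfolding p using tableaux_outside[OF assms, of i 0] by cases simp_all
qed

lemma detach_column_in_tableaux:
  assumes T: "T \<in> tableaux (Suc n)"
  shows "detach_column T \<in> tableaux n"
proof (rule tableauxI)
  fix i j assume "detach_column T (i, j) \<noteq> None"
  then show "1 \<le> i \<and> 1 \<le> j \<and> i + j \<le> n + 1"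
    using tableauxD(1)[OF T, of i "Suc j"] by (cases j) auto
next
  fix i j :: nat assume "1 \<le> i" "1 \<le> j" "i + j = n + 1"
  then show "detach_column T (i, j) \<noteq> None"
    using tableauxD(2)[OF T, of i "Suc j"] by (cases j) auto
next
  fix i j j' assume "detach_column T (i, j) = Some Beta" "j' < j"
  then show "detach_column T (i, j') = None"
    using tableauxD(3)[OF T, of i "Suc j" "Suc j'"] by (cases j; cases j') auto
next
  fix i j i' assume "detach_column T (i, j) = Some Alpha" "i' < i"
  then show "detach_column T (i', j) = None"
    using tableauxD(4)[OF T, of i "Suc j" i'] by (cases j) auto
qed

lemma first_column_in_column_fillings:
  assumes T: "T \<in> tableaux (Suc n)"
  shows "(\<lambda>i. T (i, Suc 0)) \<in> column_fillings (insert (Suc n) (free_rows n (detach_column T)))"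
proof (rule column_fillings_I)
  fix i assume i: "T (i, Suc 0) \<noteq> None"
  have "detach_column T (i, j) \<noteq> Some Beta" for j
    using tableauxD(3)[OF T, of i "Suc j" "Suc 0"] i by (cases j) auto
  then show "i \<in> insert (Suc n) (free_rows n (detach_column T))"
    using tableauxD(1)[OF T i] by (auto simp: free_rows_def)
qed (rule tableauxD(4)[OF T])

lemma attach_column_in_tableaux:
  assumes S: "S \<in> tableaux n" and c: "c \<in> column_fillings (insert (Suc n) (free_rows n S))"
    and bottom: "c (Suc n) \<noteq> None"
  shows "attach_column S c \<in> tableaux (Suc n)"
proof (rule tableauxI)
  fix i j assume *: "attach_column S c (i, j) \<noteq> None"
  consider "j = 0" | "j = Suc 0" | k where "j = Suc (Suc k)" by (metis not0_implies_Suc)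
  then show "1 \<le> i \<and> 1 \<le> j \<and> i + j \<le> Suc n + 1"
  proof cases
    case 2
    then show ?thesis using column_fillings_D(1)[OF c, of i] * by (auto simp: free_rows_def)
  next
    case 3
    then show ?thesis using tableauxD(1)[OF S, of i "Suc k"] * by auto
  qed (use * in simp)
next
  fix i j :: nat assume *: "1 \<le> i" "1 \<le> j" "i + j = Suc n + 1"
  then consider "j = Suc 0" | k where "j = Suc (Suc k)"
    by (metis One_nat_def not_less_eq_eq zero_le not0_implies_Suc)
  then show "attach_column S c (i, j) \<noteq> None"
  proof cases
    case 1
    then have "i = Suc n" using * by simp
    then show ?thesis using bottom 1 by simp
  next
    case 2
    then show ?thesis using tableauxD(2)[OF S, of i "Suc k"] * by simp
  qed
next
  fix i j j' assume *: "attach_column S c (i, j) = Some Beta" "j' < j"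
  consider "j' = 0" | k where "j' = Suc 0" "j = Suc (Suc k)"
    | k k' where "j' = Suc (Suc k')" "j = Suc (Suc k)"
    using \<open>j' < j\<close> by (metis not0_implies_Suc not_less_zero less_Suc_eq_0_disj less_antisym)
  then show "attach_column S c (i, j') = None"
  proof cases
    case 2
    then have B: "S (i, Suc k) = Some Beta" using * by simp
    then have "i \<noteq> Suc n" using tableauxD(1)[OF S, of i "Suc k"] by auto
    moreover have "i \<notin> free_rows n S" using B by (auto simp: free_rows_def)
    ultimately have "i \<notin> insert (Suc n) (free_rows n S)" by blast
    then have "c i = None" by (rule column_filling_eq_None[OF c])
    then show ?thesis using 2 by simp
  next
    case 3
    then show ?thesis using * tableauxD(3)[OF S, of i "Suc k" "Suc k'"] by simp
  qed simp
next
  fix i j i' assume *: "attach_column S c (i, j) = Some Alpha" "i' < i"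
  consider "j = 0" | "j = Suc 0" | k where "j = Suc (Suc k)" by (metis not0_implies_Suc)
  then show "attach_column S c (i', j) = None"
    using * column_fillings_D(2)[OF c, of i i'] tableauxD(4)[OF S, of i _ i'] by cases auto
qed

text \<open>
  Removing the first column maps the tableaux of size \<open>n + 1\<close> onto those of size \<open>n\<close>: the boxes \<open>(i, j)\<close>
  with \<open>i + j = n + 2\<close> and \<open>j \<ge> 2\<close> become the diagonal of the smaller one. The fibre over \<open>S\<close> consists
  of the columns whose symbols lie in free rows of \<open>S\<close> or in the new bottom row.
\<close>

lemma sum_tableaux_Suc:
  fixes f :: "filling \<Rightarrow> real"
  shows "(\<Sum>T\<in>tableaux (Suc n). f T) = (\<Sum>S\<in>tableaux n.
     \<Sum>c\<in>{c \<in> column_fillings (insert (Suc n) (free_rows n S)). c (Suc n) \<noteq> None}. f (attach_column S c))"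
proof -
  let ?C = "\<lambda>S. {c \<in> column_fillings (insert (Suc n) (free_rows n S)). c (Suc n) \<noteq> None}"
  have fin: "finite (?C S)" for S
    using finite_column_fillings[of "insert (Suc n) (free_rows n S)"] by (simp add: free_rows_def)
  have "(\<Sum>T\<in>tableaux (Suc n). f T)
      = (\<Sum>(S, c)\<in>Sigma (tableaux n) ?C. f (attach_column S c))"
  proof (rule sum.reindex_bij_witness[of _ "\<lambda>(S, c). attach_column S c"
           "\<lambda>T. (detach_column T, \<lambda>i. T (i, Suc 0))"])
    fix T assume T: "T \<in> tableaux (Suc n)"
    show "(case (detach_column T, \<lambda>i. T (i, Suc 0)) of (S, c) \<Rightarrow> attach_column S c) = T"
      using attach_detach_column[OF T] by simp
    show "(case (detach_column T, \<lambda>i. T (i, Suc 0)) of (S, c) \<Rightarrow> f (attach_column S c)) = f T"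
      using attach_detach_column[OF T] by simp
    have "T (Suc n, Suc 0) \<noteq> None" by (rule tableauxD(2)[OF T]) auto
    then show "(detach_column T, \<lambda>i. T (i, Suc 0)) \<in> Sigma (tableaux n) ?C"
      using detach_column_in_tableaux[OF T] first_column_in_column_fillings[OF T] by blast
  next
    fix p assume "p \<in> Sigma (tableaux n) ?C"
    then obtain S c where p: "p = (S, c)" "S \<in> tableaux n"
      "c \<in> column_fillings (insert (Suc n) (free_rows n S))" "c (Suc n) \<noteq> None" by blast
    show "(detach_column (case p of (S, c) \<Rightarrow> attach_column S c),
            \<lambda>i. (case p of (S, c) \<Rightarrow> attach_column S c) (i, Suc 0)) = p"
      unfolding p(1) using detach_attach_column[OF p(2)] by simp
    show "(case p of (S, c) \<Rightarrow> attach_column S c) \<in> tableaux (Suc n)"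
      unfolding p(1) using attach_column_in_tableaux[OF p(2-4)] by simp
  qed
  also have "\<dots> = (\<Sum>S\<in>tableaux n. \<Sum>c\<in>?C S. f (attach_column S c))"
    using fin finite_tableaux by (intro sum.Sigma[symmetric]) auto
  finally show ?thesis .
qed


section \<open>The generating function of the tableaux\<close>

lemma card_attach_column:
  assumes "S \<in> tableaux n" "finite {i. c i = Some s}"
  shows "card {p. attach_column S c p = Some s} = card {p. S p = Some s} + card {i. c i = Some s}"
proof -
  have S: "S (i, 0) = None" for i using tableaux_outside[OF assms(1)] by simp
  have "{p. attach_column S c p = Some s} =
      (\<lambda>(i, j). (i, Suc j)) ` {p. S p = Some s} \<union> (\<lambda>i. (i, 1)) ` {i. c i = Some s}" (is "?L = ?A \<union> ?B")
  proof (intro equalityI subsetI)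
    fix p assume p: "p \<in> ?L"
    obtain i j where ij: "p = (i, j)" by (cases p)
    consider "j = 0" | "j = Suc 0" | k where "j = Suc (Suc k)" by (metis not0_implies_Suc)
    then show "p \<in> ?A \<union> ?B" using p ij by cases (auto simp: image_iff)
  next
    fix p assume "p \<in> ?A \<union> ?B"
    then consider i j where "p = (i, Suc j)" "S (i, j) = Some s"
      | i where "p = (i, 1)" "c i = Some s" by auto
    then show "p \<in> ?L"
    proof cases
      case (1 i j)
      then show ?thesis using S[of i] by (cases j) auto
    qed simp
  qed
  moreover have "finite {p. S p = Some s}"
  proof (rule finite_subset[OF _ finite_boxes[of n]])
    show "{p. S p = Some s} \<subseteq> boxes n"
      using tableauxD(1)[OF assms(1)] by (fastforce simp: boxes_def)
  qed
  moreover have "?A \<inter> ?B = {}" using S by auto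
  ultimately have "card {p. attach_column S c p = Some s} = card ?A + card ?B"
    using assms(2) by (simp add: card_Un_disjoint)
  also have "card ?A = card {p. S p = Some s}" by (rule card_image) (auto simp: inj_on_def)
  also have "card ?B = card {i. c i = Some s}" by (rule card_image) (auto simp: inj_on_def)
  finally show ?thesis .
qed

lemma diag_alpha_attach_column:
  assumes "S \<in> tableaux n"
  shows "diag_alpha (Suc n) (attach_column S c) =
           diag_alpha n S + (if c (Suc n) = Some Alpha then 1 else 0)"
proof -
  let ?D = "{(i, j) \<in> boxes n. i + j = n + 1 \<and> S (i, j) = Some Alpha}"
  let ?B = "if c (Suc n) = Some Alpha then {(Suc n, 1::nat)} else {}"
  have "{(i, j) \<in> boxes (Suc n). i + j = Suc n + 1 \<and> attach_column S c (i, j) = Some Alpha}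
      = (\<lambda>(i, j). (i, Suc j)) ` ?D \<union> ?B" (is "?L = ?A \<union> ?B")
  proof (intro equalityI subsetI)
    fix p assume p: "p \<in> ?L"
    obtain i j where ij: "p = (i, j)" by (cases p)
    show "p \<in> ?A \<union> ?B"
    proof (cases "j = 1")
      case True
      with p ij show ?thesis by (auto simp: boxes_def attach_column_def)
    next
      case False
      with p ij have "(i, j - 1) \<in> ?D" "p = (i, Suc (j - 1))"
        by (auto simp: boxes_def attach_column_def)
      then have "p \<in> ?A" by force
      then show ?thesis by blast
    qed
  qed (auto simp: boxes_def attach_column_def split: if_splits)
  moreover have "finite ?A"
    by (intro finite_imageI finite_subset[OF _ finite_boxes[of n]]) auto
  moreover have "finite ?B" by simp
  moreover have "?A \<inter> ?B = {}" by (auto simp: boxes_def)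
  ultimately have "card ?L = card ?A + card ?B"
    by (simp only: card_Un_disjoint)
  also have "card ?A = card ?D" by (rule card_image) (auto simp: inj_on_def)
  finally show ?thesis by (simp add: diag_alpha_def)
qed

lemma free_rows_attach_column:
  assumes "S \<in> tableaux n" 
  shows "free_rows (Suc n) (attach_column S c) =
           {i \<in> insert (Suc n) (free_rows n S). c i \<noteq> Some Beta}"
proof -
  have S0: "S (i, 0) = None" "S (Suc n, j) = None" for i j
    by (rule tableaux_outside[OF assms], linarith)+
  have "(\<forall>j. attach_column S c (i, j) \<noteq> Some Beta) \<longleftrightarrow>
          c i \<noteq> Some Beta \<and> (\<forall>j. S (i, j) \<noteq> Some Beta)" (is "?l \<longleftrightarrow> ?r") for i
  proof
    assume l: ?l
    have "S (i, j) \<noteq> Some Beta" for j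
      using l[rule_format, of "Suc j"] S0(1)[of i] by (cases j) auto
    then show ?r using l[rule_format, of "Suc 0"] by simp
  next
    assume r: ?r
    then show ?l by (auto simp: attach_column_def)
  qed
  then show ?thesis unfolding free_rows_def using S0 by (auto simp: le_Suc_eq)
qed

text \<open>
  The additional variable \<open>y\<close>, which marks rows without \<open>\<beta>\<close>, is what makes an induction possible:
  summing over the first column gives the generating function of size \<open>n + 1\<close> at \<open>y\<close> from that of size
  \<open>n\<close> at \<open>y\<close> and at \<open>y + \<beta>\<close>. In terms of \<open>b = y / \<beta>\<close> the latter shift is \<open>b + 1\<close>, and the recursion
  becomes \<open>euler_poly_shift\<close>.
\<close>

lemma tableaux_generating_function:
  assumes "\<alpha> \<noteq> 0" "\<beta> \<noteq> 0"
  shows "(\<Sum>S\<in>tableaux n. weight \<alpha> \<beta> S * x ^ diag_alpha n S * y ^ card (free_rows n S))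
           = (\<alpha> * \<beta>) ^ n * poly (euler_poly (1 / \<alpha>) (y / \<beta>) n) x"
proof (induction n arbitrary: y)
  case 0
  have "tableaux 0 = {\<lambda>_. None}" by (auto simp: tableaux_def boxes_def)
  then show ?case
    by (simp add: weight_def N_alpha_def N_beta_def diag_alpha_def free_rows_def)
next
  case (Suc n)
  let ?w = "\<lambda>S. weight \<alpha> \<beta> S * x ^ diag_alpha n S"
  let ?G = "\<lambda>y. \<Sum>S\<in>tableaux n. ?w S * y ^ card (free_rows n S)"
  have "(\<Sum>S\<in>tableaux (Suc n). weight \<alpha> \<beta> S * x ^ diag_alpha (Suc n) S * y ^ card (free_rows (Suc n) S))
      = (\<Sum>S\<in>tableaux n. ?w S * ((\<beta> + \<alpha> * y) * (y + \<beta>) ^ card (free_rows n S)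
            + \<alpha> * y * (x - 1) * y ^ card (free_rows n S)))"
    unfolding sum_tableaux_Suc
  proof (intro sum.cong refl)
    fix S assume S: "S \<in> tableaux n"
    let ?F = "free_rows n S"
    have F: "finite ?F" "\<forall>i\<in>?F. i < Suc n" by (auto simp: free_rows_def)
    have "weight \<alpha> \<beta> (attach_column S c) * x ^ diag_alpha (Suc n) (attach_column S c)
            * y ^ card (free_rows (Suc n) (attach_column S c))
        = ?w S * ((if c (Suc n) = Some Alpha then x else 1) * column_weight \<alpha> \<beta> y (insert (Suc n) ?F) c)"
      if c: "c \<in> column_fillings (insert (Suc n) ?F)" for c
    proof -
      have fin: "finite {i. c i = Some s}" for s
        by (rule finite_subset[of _ "insert (Suc n) ?F"]) (use c F(1) in \<open>auto simp: column_fillings_def\<close>)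
      show ?thesis
        unfolding weight_def N_alpha_def N_beta_def card_attach_column[OF S fin]
          diag_alpha_attach_column[OF S] free_rows_attach_column[OF S]
        by (subst column_weight_eq_powers) (use c F in \<open>auto simp: power_add\<close>)
    qed
    then have "(\<Sum>c\<in>{c \<in> column_fillings (insert (Suc n) ?F). c (Suc n) \<noteq> None}.
          weight \<alpha> \<beta> (attach_column S c) * x ^ diag_alpha (Suc n) (attach_column S c)
            * y ^ card (free_rows (Suc n) (attach_column S c)))
        = ?w S * (\<Sum>c\<in>{c \<in> column_fillings (insert (Suc n) ?F). c (Suc n) \<noteq> None}.
            (if c (Suc n) = Some Alpha then x else 1) * column_weight \<alpha> \<beta> y (insert (Suc n) ?F) c)"
      unfolding sum_distrib_left by (intro sum.cong) auto
    then show "(\<Sum>c\<in>{c \<in> column_fillings (insert (Suc n) ?F). c (Suc n) \<noteq> None}.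
          weight \<alpha> \<beta> (attach_column S c) * x ^ diag_alpha (Suc n) (attach_column S c)
            * y ^ card (free_rows (Suc n) (attach_column S c)))
        = ?w S * ((\<beta> + \<alpha> * y) * (y + \<beta>) ^ card ?F + \<alpha> * y * (x - 1) * y ^ card ?F)"
      unfolding sum_column_weight_nonempty_bottom[OF F] .
  qed
  also have "\<dots> = (\<beta> + \<alpha> * y) * ?G (y + \<beta>) + \<alpha> * y * (x - 1) * ?G y"
    unfolding sum_distrib_left sum.distrib[symmetric]
    by (intro sum.cong) (simp_all add: algebra_simps)
  also have "\<dots> = (\<alpha> * \<beta>) ^ Suc n * (y / \<beta> * ((x - 1) * poly (euler_poly (1 / \<alpha>) (y / \<beta>) n) x)
      + (1 / \<alpha> + y / \<beta>) * poly (euler_poly (1 / \<alpha>) (y / \<beta> + 1) n) x)"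
    unfolding Suc.IH using assms by (simp add: add_divide_distrib) (simp add: field_simps)
  also have "\<dots> = (\<alpha> * \<beta>) ^ Suc n * poly (euler_poly (1 / \<alpha>) (y / \<beta>) (Suc n)) x"
    unfolding euler_poly_shift by (simp add: algebra_simps)
  finally show ?case .
qed


section \<open>Distributions with real-rooted generating function\<close>

lemma poly_eqI_infinite:
  fixes p q :: "'a::idom poly"
  assumes "infinite A" "\<And>x. x \<in> A \<Longrightarrow> poly p x = poly q x"
  shows "p = q"
proof (rule ccontr)
  assume "p \<noteq> q"
  then have "finite {x. poly (p - q) x = 0}" by (intro poly_roots_finite) simp
  moreover have "A \<subseteq> {x. poly (p - q) x = 0}" using assms(2) by auto
  ultimately show False using assms(1) finite_subset by blast
qed

text \<open>
  A distribution on finitely many natural numbers can be read off from the values of its probability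
  generating function on any infinite set; nonnegative arguments keep all the random variables
  \<open>x ^ k\<close> nonnegative.
\<close>

lemma pmf_eq_coeff_if_pgf:
  fixes M :: "nat pmf"
  assumes fin: "finite (set_pmf M)"
    and pgf: "\<And>x. x \<ge> 0 \<Longrightarrow> measure_pmf.expectation M (\<lambda>k. x ^ k) = poly g x"
  shows "pmf M k = coeff g k"
proof -
  define q where "q = (\<Sum>j\<in>set_pmf M. monom (pmf M j) j)"
  have "q = g"
  proof (rule poly_eqI_infinite)
    show "infinite {0::real..}" by (rule infinite_Ici)
    fix x :: real assume "x \<in> {0..}"
    then have "poly g x = measure_pmf.expectation M (\<lambda>k. x ^ k)" by (simp add: pgf)
    also have "\<dots> = (\<Sum>j\<in>set_pmf M. pmf M j * x ^ j)"
      by (subst integral_measure_pmf[OF fin]) auto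
    also have "\<dots> = poly q x" by (simp add: q_def poly_sum poly_monom)
    finally show "poly q x = poly g x" by simp
  qed
  have "coeff q k = (\<Sum>j\<in>set_pmf M. if j = k then pmf M j else 0)"
    by (simp add: q_def coeff_sum)
  also have "\<dots> = pmf M k" using fin by (simp add: set_pmf_iff)
  finally show ?thesis using \<open>q = g\<close> by simp
qed

lemma pgf_bernoulli_sum:
  assumes p: "\<And>i. i \<in> I \<Longrightarrow> p i \<in> {0..1}" and "finite I" and "x \<ge> 0"
  shows "measure_pmf.expectation (map_pmf (\<lambda>\<omega>. \<Sum>i\<in>I. of_bool (\<omega> i))
             (Pi_pmf I False (\<lambda>i. bernoulli_pmf (p i)))) (\<lambda>k::nat. x ^ k)
         = (\<Prod>i\<in>I. p i * x + (1 - p i))"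
proof -
  have "measure_pmf.expectation (map_pmf (\<lambda>\<omega>. \<Sum>i\<in>I. of_bool (\<omega> i))
             (Pi_pmf I False (\<lambda>i. bernoulli_pmf (p i)))) (\<lambda>k::nat. x ^ k)
      = measure_pmf.expectation (Pi_pmf I False (\<lambda>i. bernoulli_pmf (p i)))
          (\<lambda>\<omega>. \<Prod>i\<in>I. x ^ of_bool (\<omega> i))"
    by (simp add: power_sum)
  also have "\<dots> = (\<Prod>i\<in>I. measure_pmf.expectation (bernoulli_pmf (p i)) (\<lambda>v. x ^ of_bool v))"
    using assms by (intro expectation_prod_Pi_pmf integrable_measure_pmf_finite) auto
  also have "\<dots> = (\<Prod>i\<in>I. p i * x + (1 - p i))"
    using p by (intro prod.cong) (auto simp: mult.commute)
  finally show ?thesis .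
qed

lemma finite_set_bernoulli_sum:
  assumes "finite I"
  shows "finite (set_pmf (map_pmf (\<lambda>\<omega>. \<Sum>i\<in>I. of_bool (\<omega> i) :: nat) (Pi_pmf I False P)))"
proof -
  have "(\<Sum>i\<in>I. of_bool (\<omega> i)) \<le> card I" for \<omega>
    using sum_bounded_above[of I "\<lambda>i. of_bool (\<omega> i) :: nat" 1] by simp
  then have "set_pmf (map_pmf (\<lambda>\<omega>. \<Sum>i\<in>I. of_bool (\<omega> i) :: nat) (Pi_pmf I False P)) \<subseteq> {..card I}"
    by auto
  then show ?thesis by (rule finite_subset) simp
qed

text \<open>
  As the generating function is \<open>1\<close> at \<open>x = 1\<close>, it equals \<open>(\<Prod>r\<in>R. (x + r) / (1 + r))\<close>, and the
  factor \<open>(x + r) / (1 + r)\<close> is the generating function of a Bernoulli variable with parameter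
  \<open>1 / (1 + r)\<close>. The summands in excess of \<open>card R\<close> get the parameter \<open>0\<close>.
\<close>

lemma bernoulli_sum_if_pgf_real_rooted:
  fixes M :: "nat pmf"
  assumes M: "finite (set_pmf M)"
    and pgf: "\<And>x::real. x \<ge> 0 \<Longrightarrow> measure_pmf.expectation M (\<lambda>k. x ^ k) = c * (\<Prod>r\<in>R. x + r)"
    and R: "finite R" "card R \<le> n" "R \<subseteq> {0..}"
  shows "\<exists>p :: nat \<Rightarrow> real. (\<forall>i \<in> {1..n}. p i \<in> {0..1}) \<and>
           M = map_pmf (\<lambda>\<omega>. \<Sum>i = 1..n. of_bool (\<omega> i)) (Pi_pmf {1..n} False (\<lambda>i. bernoulli_pmf (p i)))"
proof -
  obtain h where h: "bij_betw h {1..card R} R"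
    using ex_bij_betw_nat_finite_1[OF R(1)] by blast
  have h_nonneg: "h i \<ge> 0" if "i \<in> {1..card R}" for i
    using bij_betwE[OF h] that R(3) by auto
  define p where "p i = (if i \<le> card R then 1 / (1 + h i) else 0)" for i
  have p: "p i \<in> {0..1}" if "i \<in> {1..n}" for i
    using h_nonneg[of i] that by (auto simp: p_def divide_simps)
  define N where "N = map_pmf (\<lambda>\<omega>. \<Sum>i = 1..n. of_bool (\<omega> i) :: nat)
      (Pi_pmf {1..n} False (\<lambda>i. bernoulli_pmf (p i)))"
  have N: "finite (set_pmf N)" unfolding N_def by (rule finite_set_bernoulli_sum) simp
  have "c * (\<Prod>r\<in>R. 1 + r) = 1" using pgf[of 1] by simp
  then have c: "c = 1 / (\<Prod>r\<in>R. 1 + r)" by (metis mult_zero_right nonzero_eq_divide_eq zero_neq_one)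
  have "(\<Prod>i\<in>{1..n}. p i * x + (1 - p i)) = c * (\<Prod>r\<in>R. x + r)" for x
  proof -
    have "(\<Prod>i\<in>{1..n}. p i * x + (1 - p i)) = (\<Prod>i\<in>{1..card R}. p i * x + (1 - p i))"
      using R(2) by (intro prod.mono_neutral_right) (auto simp: p_def)
    also have "\<dots> = (\<Prod>i\<in>{1..card R}. (x + h i) / (1 + h i))"
    proof (intro prod.cong refl)
      fix i assume i: "i \<in> {1..card R}"
      have "1 + h i \<noteq> 0" using h_nonneg[OF i] by simp
      then have "1 - 1 / (1 + h i) = h i / (1 + h i)" by (simp add: field_simps)
      then show "p i * x + (1 - p i) = (x + h i) / (1 + h i)"
        using i by (simp add: p_def add_divide_distrib)
    qed
    also have "\<dots> = (\<Prod>r\<in>R. (x + r) / (1 + r))" by (rule prod.reindex_bij_betw[OF h])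
    also have "\<dots> = c * (\<Prod>r\<in>R. x + r)"
      unfolding c by (simp add: prod_dividef)
    finally show ?thesis .
  qed
  then have pgfN: "measure_pmf.expectation N (\<lambda>k. x ^ k) = c * (\<Prod>r\<in>R. x + r)" if "x \<ge> 0" for x
    unfolding N_def using pgf_bernoulli_sum[of "{1..n}" p x] p that by simp
  let ?g = "smult c (\<Prod>r\<in>R. [:r, 1:])"
  have g: "poly ?g x = c * (\<Prod>r\<in>R. x + r)" for x by (simp add: poly_prod add.commute)
  have "pmf M k = coeff ?g k" for k
    by (rule pmf_eq_coeff_if_pgf[OF M]) (simp only: pgf g)
  moreover have "pmf N k = coeff ?g k" for k
    by (rule pmf_eq_coeff_if_pgf[OF N]) (simp only: pgfN g)
  ultimately have "pmf M k = pmf N k" for k by (simp only:)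
  then have "M = N" by (rule pmf_eqI)
  then show ?thesis using p unfolding N_def by blast
qed

lemma order_prod_linear_factors:
  fixes c :: "'a::field_char_0"
  assumes c: "c \<noteq> 0" and R: "finite R" and root: "poly (smult c (\<Prod>r\<in>R. [:r, 1:])) z = 0"
  shows "- z \<in> R" and "order z (smult c (\<Prod>r\<in>R. [:r, 1:])) = 1"
proof -
  from root c R show z: "- z \<in> R" by (auto simp: poly_prod add_eq_0_iff)
  define q where "q = smult c (\<Prod>r\<in>R - {- z}. [:r, 1:])"
  have eq: "smult c (\<Prod>r\<in>R. [:r, 1:]) = [:-z, 1:] * q"
    using prod.remove[OF R z, of "\<lambda>r. [:r, 1:]"] by (simp add: q_def)
  have "poly q z \<noteq> 0" using c R by (auto simp: q_def poly_prod add_eq_0_iff)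
  then have ndvd: "\<not> [:-z, 1:] dvd q" by (simp add: poly_eq_0_iff_dvd)
  show "order z (smult c (\<Prod>r\<in>R. [:r, 1:])) = 1"
  proof (rule order_unique_lemma)
    show "[:-z, 1:] ^ 1 dvd smult c (\<Prod>r\<in>R. [:r, 1:])" unfolding eq power_one_right by (rule dvd_triv_left)
    have "[:-z, 1:] * [:-z, 1:] dvd [:-z, 1:] * q \<longleftrightarrow> [:-z, 1:] dvd q"
      by (rule dvd_times_left_cancel_iff) simp
    then show "\<not> [:-z, 1:] ^ Suc 1 dvd smult c (\<Prod>r\<in>R. [:r, 1:])"
      unfolding eq using ndvd by (simp only: power_Suc power_0 mult_1_right One_nat_def) simp
  qed
qed


section \<open>The distribution of the diagonal, with limits\<close>

lemma diag_alpha_pgf_finite: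
  assumes "\<alpha> > 0" "\<beta> > 0"
  shows "(\<Sum>S\<in>tableaux n. tableau_prob n \<alpha> \<beta> S * x ^ diag_alpha n S)
           = poly (euler_poly (1 / \<alpha>) (1 / \<beta>) n) x / poly (euler_poly (1 / \<alpha>) (1 / \<beta>) n) 1"
proof -
  have gf: "(\<Sum>S\<in>tableaux n. weight \<alpha> \<beta> S * x ^ diag_alpha n S)
      = (\<alpha> * \<beta>) ^ n * poly (euler_poly (1 / \<alpha>) (1 / \<beta>) n) x" for x
    using tableaux_generating_function[where y = 1 and x = x and n = n and \<alpha> = \<alpha> and \<beta> = \<beta>] assms by simp
  have Z: "Z_tab n \<alpha> \<beta> = (\<alpha> * \<beta>) ^ n * poly (euler_poly (1 / \<alpha>) (1 / \<beta>) n) 1"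
    using gf[of 1] by (simp add: Z_tab_def)
  have "(\<Sum>S\<in>tableaux n. tableau_prob n \<alpha> \<beta> S * x ^ diag_alpha n S)
      = (\<Sum>S\<in>tableaux n. weight \<alpha> \<beta> S * x ^ diag_alpha n S) / Z_tab n \<alpha> \<beta>"
    unfolding sum_divide_distrib by (intro sum.cong) (simp_all add: tableau_prob_def)
  then show ?thesis using assms by (simp add: gf Z)
qed

text \<open>
  If the limiting polynomial vanishes identically, as for \<open>\<alpha> = \<beta> = \<infinity>\<close>, it has to be rescaled before
  passing to the limit; the factor \<open>h\<close> cancels in the quotient.
\<close>

lemma diag_alpha_pgf_limit:
  fixes f g h :: "real \<Rightarrow> real"
  assumes q: "\<And>S. ((\<lambda>t. tableau_prob n (f t) (g t) S) \<longlongrightarrow> q S) at_top"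
    and pos: "\<forall>\<^sub>F t in at_top. f t > 0 \<and> g t > 0 \<and> h t > 0"
    and lim: "\<And>x. ((\<lambda>t. h t * poly (euler_poly (1 / f t) (1 / g t) n) x) \<longlongrightarrow> poly L x) at_top"
    and L1: "poly L 1 \<noteq> 0"
  shows "(\<Sum>S\<in>tableaux n. q S * x ^ diag_alpha n S) = poly L x / poly L 1"
proof (rule tendsto_unique[of at_top])
  show "((\<lambda>t. \<Sum>S\<in>tableaux n. tableau_prob n (f t) (g t) S * x ^ diag_alpha n S) \<longlongrightarrow>
      (\<Sum>S\<in>tableaux n. q S * x ^ diag_alpha n S)) at_top"
    by (intro tendsto_sum tendsto_mult q tendsto_const)
  have "((\<lambda>t. (h t * poly (euler_poly (1 / f t) (1 / g t) n) x) /
        (h t * poly (euler_poly (1 / f t) (1 / g t) n) 1)) \<longlongrightarrow> poly L x / poly L 1) at_top"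
    by (intro tendsto_divide lim L1)
  moreover have "\<forall>\<^sub>F t in at_top. (h t * poly (euler_poly (1 / f t) (1 / g t) n) x) /
        (h t * poly (euler_poly (1 / f t) (1 / g t) n) 1)
      = (\<Sum>S\<in>tableaux n. tableau_prob n (f t) (g t) S * x ^ diag_alpha n S)"
    using pos by eventually_elim (simp add: diag_alpha_pgf_finite)
  ultimately show "((\<lambda>t. \<Sum>S\<in>tableaux n. tableau_prob n (f t) (g t) S * x ^ diag_alpha n S)
      \<longlongrightarrow> poly L x / poly L 1) at_top"
    by (rule Lim_transform_eventually)
qed simp

lemma tendsto_inverse_at_top_0: "((\<lambda>t::real. 1 / t) \<longlongrightarrow> 0) at_top"
  by (rule real_tendsto_divide_at_top[OF tendsto_const filterlim_ident])

text \<open>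
  For \<open>\<alpha> = \<beta> = t\<close> tending to infinity, \<open>euler_poly (1 / t) (1 / t) n\<close> tends to zero like a multiple of \<open>1 / t\<close>. By
  \<open>euler_poly_shift\<close> the rescaled limit is \<open>euler_poly 0 1 (n - 1)\<close>, which is nonzero; the
  other summand of the shift identity contains \<open>euler_poly 0 0 (n - 1) = 0\<close>. This needs \<open>n \<ge> 2\<close>.
  In all other cases the polynomial \<open>euler_poly a b n\<close> itself has a nonzero limit.
\<close>

lemma diag_alpha_pgf:
  fixes \<alpha> \<beta> :: ereal
  assumes "\<alpha> > 0" "\<beta> > 0"
    and a: "a = real_of_ereal (inverse \<alpha>)" and b: "b = real_of_ereal (inverse \<beta>)"
    and "\<alpha> = \<infinity> \<and> \<beta> = \<infinity> \<longrightarrow> n = Suc m \<and> m \<ge> 1"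
    and L: "L = (if \<alpha> = \<infinity> \<and> \<beta> = \<infinity> then euler_poly 0 1 m else euler_poly a b n)"
  shows "a \<ge> 0" "b \<ge> 0" "a = 0 \<longleftrightarrow> \<alpha> = \<infinity>" "b = 0 \<longleftrightarrow> \<beta> = \<infinity>" "poly L 1 > 0"
    and "(\<Sum>S\<in>tableaux n. tableau_prob_ext n \<alpha> \<beta> S * x ^ diag_alpha n S) = poly L x / poly L 1"
    and "S \<notin> tableaux n \<Longrightarrow> tableau_prob_ext n \<alpha> \<beta> S = 0"
proof -
  obtain "a \<ge> 0" "a = 0 \<longleftrightarrow> \<alpha> = \<infinity>" using assms(1) a by (cases \<alpha>) auto
  obtain "b \<ge> 0" "b = 0 \<longleftrightarrow> \<beta> = \<infinity>" using assms(2) b by (cases \<beta>) auto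
  show "a \<ge> 0" "b \<ge> 0" "a = 0 \<longleftrightarrow> \<alpha> = \<infinity>" "b = 0 \<longleftrightarrow> \<beta> = \<infinity>" by fact+
  show L1: "poly L 1 > 0"
  proof (cases "\<alpha> = \<infinity> \<and> \<beta> = \<infinity>")
    case True
    then show ?thesis using poly_euler_poly_1_pos[of 0 1 m] by (simp add: L)
  next
    case False
    then have "a + b > 0"
      using \<open>a \<ge> 0\<close> \<open>b \<ge> 0\<close> \<open>a = 0 \<longleftrightarrow> _\<close> \<open>b = 0 \<longleftrightarrow> _\<close> by linarith
    then have "poly (euler_poly a b n) 1 > 0"
      using \<open>a \<ge> 0\<close> \<open>b \<ge> 0\<close> by (intro poly_euler_poly_1_pos)
    then show ?thesis unfolding L if_not_P[OF False] .
  qed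
  obtain f g h :: "real \<Rightarrow> real" where
    q: "\<And>S. ((\<lambda>t. tableau_prob n (f t) (g t) S) \<longlongrightarrow> tableau_prob_ext n \<alpha> \<beta> S) at_top"
    and pos: "\<forall>\<^sub>F t in at_top. f t > 0 \<and> g t > 0 \<and> h t > 0"
    and lim: "\<And>x. ((\<lambda>t. h t * poly (euler_poly (1 / f t) (1 / g t) n) x) \<longlongrightarrow> poly L x) at_top"
  proof (cases "\<alpha> = \<infinity>"; cases "\<beta> = \<infinity>")
    assume inf: "\<alpha> = \<infinity>" "\<beta> = \<infinity>"
    then have n: "n = Suc m" "m \<ge> 1" using assms(5) by auto
    have zero: "euler_poly 0 0 m = 0" using n(2) by (cases m) (simp_all only: euler_poly_b_0, simp_all)
    show ?thesis
    proof (rule that[of "\<lambda>t. t" "\<lambda>t. t" "\<lambda>t. t / 2"])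
      show "((\<lambda>t. tableau_prob n t t S) \<longlongrightarrow> tableau_prob_ext n \<alpha> \<beta> S) at_top" for S
        unfolding inf by (rule tableau_prob_tendsto(1)[of 1 1]) simp_all
      show "\<forall>\<^sub>F t in at_top. t > 0 \<and> t > 0 \<and> t / 2 > (0::real)"
        using eventually_gt_at_top[of 0] by eventually_elim simp
      fix x :: real
      let ?R = "\<lambda>t. (x - 1) / 2 * poly (euler_poly (1 / t) (1 / t) m) x
          + poly (euler_poly (1 / t) (1 / t + 1) m) x"
      have "(?R \<longlongrightarrow> (x - 1) / 2 * poly (euler_poly 0 0 m) x + poly (euler_poly 0 (0 + 1) m) x) at_top"
        by (intro tendsto_intros tendsto_poly_euler_poly tendsto_inverse_at_top_0)
      also have "(x - 1) / 2 * poly (euler_poly 0 0 m) x + poly (euler_poly 0 (0 + 1) m) x = poly L x"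
        unfolding zero L using inf by simp
      finally have "(?R \<longlongrightarrow> poly L x) at_top" .
      moreover have "\<forall>\<^sub>F t in at_top. ?R t = t / 2 * poly (euler_poly (1 / t) (1 / t) n) x"
        using eventually_gt_at_top[of 0]
        by eventually_elim (simp add: n(1) euler_poly_shift field_simps del: euler_poly.simps)
      ultimately show "((\<lambda>t. t / 2 * poly (euler_poly (1 / t) (1 / t) n) x) \<longlongrightarrow> poly L x) at_top"
        by (rule Lim_transform_eventually)
    qed
  next
    assume inf: "\<alpha> = \<infinity>" "\<beta> \<noteq> \<infinity>"
    with assms obtain b' where b': "\<beta> = ereal b'" "b' > 0" by (cases \<beta>) auto
    have L': "L = euler_poly 0 (1 / b') n" using inf b' a b by (simp add: L inverse_eq_divide)
    show ?thesis
    proof (rule that[of "\<lambda>t. t" "\<lambda>_. b'" "\<lambda>_. 1"])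
      show "((\<lambda>t. tableau_prob n t b' S) \<longlongrightarrow> tableau_prob_ext n \<alpha> \<beta> S) at_top" for S
        unfolding inf b'(1) by (rule tableau_prob_tendsto(2)[of 1]) (simp_all add: b')
      show "\<forall>\<^sub>F t in at_top. t > (0::real) \<and> b' > 0 \<and> 1 > (0::real)"
        using eventually_gt_at_top[of 0] by eventually_elim (simp add: b')
      show "((\<lambda>t. 1 * poly (euler_poly (1 / t) (1 / b') n) x) \<longlongrightarrow> poly L x) at_top" for x
        unfolding L' mult_1_left
        by (intro tendsto_poly_euler_poly tendsto_inverse_at_top_0 tendsto_const)
    qed
  next
    assume inf: "\<alpha> \<noteq> \<infinity>" "\<beta> = \<infinity>"
    with assms obtain a' where a': "\<alpha> = ereal a'" "a' > 0" by (cases \<alpha>) auto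
    have L': "L = euler_poly (1 / a') 0 n" using inf a' a b by (simp add: L inverse_eq_divide)
    show ?thesis
    proof (rule that[of "\<lambda>_. a'" "\<lambda>t. t" "\<lambda>_. 1"])
      show "((\<lambda>t. tableau_prob n a' t S) \<longlongrightarrow> tableau_prob_ext n \<alpha> \<beta> S) at_top" for S
        unfolding inf a'(1) by (rule tableau_prob_tendsto(3)[of _ 1]) (simp_all add: a')
      show "\<forall>\<^sub>F t in at_top. a' > 0 \<and> t > (0::real) \<and> 1 > (0::real)"
        using eventually_gt_at_top[of 0] by eventually_elim (simp add: a')
      show "((\<lambda>t. 1 * poly (euler_poly (1 / a') (1 / t) n) x) \<longlongrightarrow> poly L x) at_top" for x
        unfolding L' mult_1_left
        by (intro tendsto_poly_euler_poly tendsto_inverse_at_top_0 tendsto_const)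
    qed
  next
    assume fin: "\<alpha> \<noteq> \<infinity>" "\<beta> \<noteq> \<infinity>"
    with assms obtain a' b' where ab': "\<alpha> = ereal a'" "a' > 0" "\<beta> = ereal b'" "b' > 0"
      by (cases \<alpha>; cases \<beta>) auto
    have L': "L = euler_poly (1 / a') (1 / b') n" using ab' a b by (simp add: L inverse_eq_divide)
    show ?thesis
      by (rule that[of "\<lambda>_. a'" "\<lambda>_. b'" "\<lambda>_. 1"])
        (use ab' in \<open>simp_all add: tableau_prob_ext_def L'\<close>)
  qed
  show "(\<Sum>S\<in>tableaux n. tableau_prob_ext n \<alpha> \<beta> S * x ^ diag_alpha n S) = poly L x / poly L 1"
    by (rule diag_alpha_pgf_limit[OF q pos lim]) (use L1 in simp)
  show "tableau_prob_ext n \<alpha> \<beta> S = 0" if "S \<notin> tableaux n"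
    by (rule tableau_prob_limit(2)[OF q _ that]) (use pos in eventually_elim, simp)
qed


section \<open>Simple roots for all parameters\<close>

text \<open>
  The set \<open>R\<close> contains the negatives of the roots. That it is a set makes them simple, and the bound
  on its size leaves room for degrees below \<open>n\<close>, which occur for \<open>\<beta> = \<infinity>\<close>.
\<close>

definition simple_nonpos_roots :: "real poly \<Rightarrow> nat \<Rightarrow> bool" where
  "simple_nonpos_roots p n \<longleftrightarrow> (\<exists>c R. c > 0 \<and> finite R \<and> card R \<le> n \<and> R \<subseteq> {0..} \<and>
     p = smult c (\<Prod>r\<in>R. [:r, 1:]))"

lemma simple_nonpos_roots_smult:
  "simple_nonpos_roots p n \<Longrightarrow> d > 0 \<Longrightarrow> simple_nonpos_roots (smult d p) n"
  unfolding simple_nonpos_roots_def by (metis mult_pos_pos smult_smult)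

lemma simple_nonpos_roots_mono:
  "simple_nonpos_roots p n \<Longrightarrow> n \<le> m \<Longrightarrow> simple_nonpos_roots p m"
  unfolding simple_nonpos_roots_def by (elim exE conjE, intro exI conjI) (assumption | simp)+

text \<open>
  Positive parameters are covered by the interlacing argument. If \<open>b = 0\<close>, one root moves to infinity;
  if \<open>a = 0\<close>, one root moves to \<open>0\<close>, where it stays simple as all other roots are strictly negative.
\<close>

lemma simple_nonpos_roots_euler_poly:
  assumes "a \<ge> 0" "b \<ge> 0" "a + b > 0"
  shows "simple_nonpos_roots (euler_poly a b n) n"
proof -
  have pos: "simple_nonpos_roots (euler_poly a b n) n" if ab: "a > 0" "b > 0" for a b n
  proof -
    obtain c R where "c > 0" "finite R" "card R = n" "R \<subseteq> {0<..}"
      "euler_poly a b n = smult c (\<Prod>r\<in>R. [:r, 1:])"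
      by (rule euler_poly_factorization[OF ab])
    moreover from this have "R \<subseteq> {0..}" by auto
    ultimately show ?thesis unfolding simple_nonpos_roots_def by blast
  qed
  show ?thesis
  proof (cases n)
    case 0
    then show ?thesis unfolding simple_nonpos_roots_def
      by (intro exI[of _ 1] exI[of _ "{}"]) simp
  next
    case (Suc k)
    consider "a > 0" "b > 0" | "b = 0" "a > 0" | "a = 0" "b > 0" using assms by linarith
    then show ?thesis
    proof cases
      case 1
      then show ?thesis by (rule pos)
    next
      case 2
      then have "simple_nonpos_roots (smult a (euler_poly a 1 k)) k"
        by (intro simple_nonpos_roots_smult pos) auto
      then show ?thesis
        unfolding 2 Suc euler_poly_b_0 by (rule simple_nonpos_roots_mono) simp
    next
      case 3
      obtain c R where R: "c > 0" "finite R" "card R = k" "R \<subseteq> {0<..}"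
        and E: "euler_poly 1 b k = smult c (\<Prod>r\<in>R. [:r, 1:])"
        by (rule euler_poly_factorization[of 1 b k]) (use 3 in auto)
      have "0 \<notin> R" using R(4) by auto
      then have "card (insert 0 R) = Suc k" "insert 0 R \<subseteq> {0..}"
        "[:0, 1:] * euler_poly 1 b k = smult c (\<Prod>r\<in>insert 0 R. [:r, 1:])"
        using R E by auto
      then have "simple_nonpos_roots ([:0, 1:] * euler_poly 1 b k) (Suc k)"
        unfolding simple_nonpos_roots_def using R
        by (intro exI[of _ c] exI[of _ "insert 0 R"]) simp
      then show ?thesis
        unfolding \<open>a = 0\<close> Suc euler_poly_a_0 using \<open>b > 0\<close> by (rule simple_nonpos_roots_smult)
    qed
  qed
qed

theorem theorem1p10:
  fixes \<alpha> \<beta> :: ereal and a b :: real and n :: nat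
  assumes "0 < \<alpha>" and "0 < \<beta>"
    and "a = real_of_ereal (inverse \<alpha>)" and "b = real_of_ereal (inverse \<beta>)"
    and "1 \<le> n" and "\<alpha> = \<infinity> \<and> \<beta> = \<infinity> \<longrightarrow> 2 \<le> n"
  shows "(\<exists>g :: complex poly.
            (\<forall>x. poly g x = measure_pmf.expectation (random_tableau n \<alpha> \<beta>) (\<lambda>S. x ^ diag_alpha n S)) \<and>
            (\<forall>z. poly g z = 0 \<longrightarrow> order z g = 1 \<and> z \<in> \<real> \<and> Re z \<le> 0)) \<and>
         (\<exists>p :: nat \<Rightarrow> real. (\<forall>i \<in> {1..n}. p i \<in> {0..1}) \<and>
            map_pmf (diag_alpha n) (random_tableau n \<alpha> \<beta>) =
            map_pmf (\<lambda>\<omega>. \<Sum>i = 1..n. of_bool (\<omega> i)) (Pi_pmf {1..n} False (\<lambda>i. bernoulli_pmf (p i)))) \<and>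
         unimodal (pmf (map_pmf (\<lambda>S. int (diag_alpha n S)) (random_tableau n \<alpha> \<beta>))) \<and>
         log_concave (pmf (map_pmf (\<lambda>S. int (diag_alpha n S)) (random_tableau n \<alpha> \<beta>))) \<and>
         unimodal (vnum a b n) \<and>
         log_concave (vnum a b n)"
proof -
  define m where "m = n - 1"
  define L where "L = (if \<alpha> = \<infinity> \<and> \<beta> = \<infinity> then euler_poly 0 1 m else euler_poly a b n)"
  have m: "n = Suc m" "\<alpha> = \<infinity> \<and> \<beta> = \<infinity> \<longrightarrow> n = Suc m \<and> m \<ge> 1"
    using assms(5,6) by (auto simp: m_def)
  note pgf = diag_alpha_pgf[OF assms(1-4) m(2) L_def]
  let ?M = "random_tableau n \<alpha> \<beta>" and ?q = "tableau_prob_ext n \<alpha> \<beta>"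
  define D where "D = map_pmf (diag_alpha n) ?M"
  have pmfM: "pmf ?M S = ?q S" for S by (rule pmf_random_tableau[OF assms(1,2)])
  have supp: "set_pmf ?M \<subseteq> tableaux n" 
  proof
    fix S assume "S \<in> set_pmf ?M"
    then have "?q S \<noteq> 0" by (simp add: set_pmf_iff pmfM)
    then show "S \<in> tableaux n" using pgf(7)[of S] by blast
  qed
  have finM: "finite (set_pmf ?M)" using supp finite_tableaux by (rule finite_subset)

  have "simple_nonpos_roots L n"
  proof (cases "\<alpha> = \<infinity> \<and> \<beta> = \<infinity>")
    case True
    have "simple_nonpos_roots (euler_poly 0 1 m) n"
      by (rule simple_nonpos_roots_mono[OF simple_nonpos_roots_euler_poly]) (simp_all add: m(1))
    then show ?thesis using True by (simp add: L_def)
  next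
    case False
    have "a + b > 0" using pgf(1-4) False by linarith
    then show ?thesis using False pgf(1,2) by (auto simp: L_def intro: simple_nonpos_roots_euler_poly)
  qed
  then have "simple_nonpos_roots (smult (1 / poly L 1) L) n"
    using pgf(5) by (intro simple_nonpos_roots_smult) simp_all
  then obtain c R where c: "c > 0" and R: "finite R" "card R \<le> n" "R \<subseteq> {0..}"
    and G: "smult (1 / poly L 1) L = smult c (\<Prod>r\<in>R. [:r, 1:])"
    unfolding simple_nonpos_roots_def by blast
  define G where "G = smult c (\<Prod>r\<in>R. [:r, 1:])"
  have polyG: "poly G x = c * (\<Prod>r\<in>R. x + r)" for x by (simp add: G_def poly_prod add.commute)
  have gf: "(\<Sum>S\<in>tableaux n. ?q S * x ^ diag_alpha n S) = poly G x" for x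
    unfolding pgf(6) G_def G[symmetric] by simp

  have "\<exists>g :: complex poly.
            (\<forall>x. poly g x = measure_pmf.expectation ?M (\<lambda>S. x ^ diag_alpha n S)) \<and>
            (\<forall>z. poly g z = 0 \<longrightarrow> order z g = 1 \<and> z \<in> \<real> \<and> Re z \<le> 0)"
  proof -
    define g where "g = smult (complex_of_real c) (\<Prod>r\<in>complex_of_real ` R. [:r, 1:])"
    \<comment> \<open>the two forms agree at real arguments, hence everywhere\<close>
    define Q where "Q = (\<Sum>S\<in>tableaux n. monom (complex_of_real (?q S)) (diag_alpha n S))"
    have "g = Q"
    proof (rule poly_eqI_infinite)
      show "infinite (range complex_of_real)"
        using finite_imageD[of complex_of_real UNIV] infinite_UNIV_char_0[where 'a = real]
        by (auto simp: inj_on_def)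
      fix z assume "z \<in> range complex_of_real"
      then obtain x where z: "z = complex_of_real x" by auto
      have "poly g z = complex_of_real (poly G x)"
        by (simp add: g_def polyG poly_prod z prod.reindex inj_on_def add.commute)
      also have "\<dots> = poly Q z" by (simp add: Q_def poly_sum poly_monom z flip: gf)
      finally show "poly g z = poly Q z" .
    qed
    have "poly g x = measure_pmf.expectation ?M (\<lambda>S. x ^ diag_alpha n S)" for x
    proof -
      have "measure_pmf.expectation ?M (\<lambda>S. x ^ diag_alpha n S)
          = (\<Sum>S\<in>tableaux n. pmf ?M S *\<^sub>R x ^ diag_alpha n S)"
        by (rule integral_measure_pmf[OF finite_tableaux]) (use supp in auto)
      also have "\<dots> = poly Q x" by (simp add: Q_def poly_sum poly_monom pmfM scaleR_conv_of_real)
      finally show ?thesis using \<open>g = Q\<close> by simp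
    qed
    moreover have "order z g = 1 \<and> z \<in> \<real> \<and> Re z \<le> 0" if "poly g z = 0" for z
    proof -
      have "- z \<in> complex_of_real ` R" "order z g = 1"
        using order_prod_linear_factors[of "complex_of_real c" "complex_of_real ` R" z] c R that
        by (simp_all add: g_def)
      moreover from this obtain r where "r \<in> R" "z = complex_of_real (- r)"
        by (metis imageE minus_equation_iff of_real_minus)
      ultimately show ?thesis using R(3) by auto
    qed
    ultimately show ?thesis by blast
  qed
  moreover have D: "finite (set_pmf D)" unfolding D_def using finM by simp
  have pgfD: "measure_pmf.expectation D (\<lambda>k. x ^ k) = poly G x" for x :: real
  proof -
    have "measure_pmf.expectation D (\<lambda>k. x ^ k) = (\<Sum>S\<in>tableaux n. pmf ?M S *\<^sub>R x ^ diag_alpha n S)"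
      unfolding D_def integral_map_pmf
      by (rule integral_measure_pmf[OF finite_tableaux]) (use supp in auto)
    then show ?thesis by (simp add: pmfM gf)
  qed
  have "\<exists>p :: nat \<Rightarrow> real. (\<forall>i \<in> {1..n}. p i \<in> {0..1}) \<and>
      D = map_pmf (\<lambda>\<omega>. \<Sum>i = 1..n. of_bool (\<omega> i)) (Pi_pmf {1..n} False (\<lambda>i. bernoulli_pmf (p i)))"
    by (rule bernoulli_sum_if_pgf_real_rooted[OF D _ R]) (simp only: pgfD polyG)
  moreover have coeffs: "unimodal u \<and> log_concave u"
    if "d \<ge> 0" and u: "\<And>k. u k = d * (if k < 0 then 0 else coeff G (nat k))" for u d
  proof -
    have "log_concave_gap (\<lambda>k. (d * c) * (if k < 0 then 0 else coeff (\<Prod>r\<in>R. [:r, 1:]) (nat k)))"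
      using c that(1) R by (intro log_concave_gap_scale log_concave_gap_coeffs) auto
    also have "(\<lambda>k. (d * c) * (if k < 0 then 0 else coeff (\<Prod>r\<in>R. [:r, 1:]) (nat k))) = u"
      by (auto simp: u G_def)
    finally have "log_concave_gap u" .
    moreover have "finite {k. u k \<noteq> 0}"
    proof (rule finite_subset)
      show "{k. u k \<noteq> 0} \<subseteq> {0..int (degree G)}"
      proof
        fix k assume "k \<in> {k. u k \<noteq> 0}"
        then have "\<not> k < 0" "coeff G (nat k) \<noteq> 0" by (auto simp: u split: if_splits)
        then show "k \<in> {0..int (degree G)}" using le_degree[of G "nat k"] by auto
      qed
    qed simp
    ultimately show ?thesis
      by (blast intro: log_concave_gap_imp_unimodal log_concave_gap_imp_log_concave)
  qed
  have "pmf (map_pmf (\<lambda>S. int (diag_alpha n S)) ?M) k = 1 * (if k < 0 then 0 else coeff G (nat k))" for k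
  proof -
    have eq: "map_pmf (\<lambda>S. int (diag_alpha n S)) ?M = map_pmf int D"
      by (simp add: D_def pmf.map_comp comp_def)
    show ?thesis
    proof (cases "k < 0")
      case True
      then have "k \<notin> int ` set_pmf D" by auto
      then show ?thesis unfolding eq using True by (simp add: pmf_map_outside)
    next
      case False
      then have "pmf (map_pmf int D) k = pmf D (nat k)"
        using pmf_map_inj'[of int D "nat k"] by simp
      also have "\<dots> = coeff G (nat k)"
        by (rule pmf_eq_coeff_if_pgf[OF D]) (rule pgfD)
      finally show ?thesis unfolding eq using False by simp
    qed
  qed
  from coeffs[OF _ this] have "unimodal (pmf (map_pmf (\<lambda>S. int (diag_alpha n S)) ?M))"
    "log_concave (pmf (map_pmf (\<lambda>S. int (diag_alpha n S)) ?M))" by simp_all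
  moreover have "unimodal (vnum a b n) \<and> log_concave (vnum a b n)"
  proof (cases "\<alpha> = \<infinity> \<and> \<beta> = \<infinity>")
    case True
    then have "a = 0" "b = 0" using pgf(3,4) by auto
    \<comment> \<open>for \<open>\<alpha> = \<beta> = \<infinity>\<close> the numbers \<open>v\<^sub>0\<^sub>,\<^sub>0(n, k)\<close> all vanish\<close>
    then have "euler_poly a b n = 0" by (simp only: m(1) euler_poly_b_0) simp
    then have "vnum a b n k = 0 * (if k < 0 then 0 else coeff G (nat k))" for k
      by (simp add: vnum_eq_coeff_euler_poly)
    from coeffs[OF _ this] show ?thesis by simp
  next
    case False
    have "euler_poly a b n = L" unfolding L_def if_not_P[OF False] ..
    also have "L = smult (poly L 1) G"
      unfolding G_def G[symmetric] using pgf(5) by simp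
    finally have "euler_poly a b n = smult (poly L 1) G" .
    then have "vnum a b n k = poly L 1 * (if k < 0 then 0 else coeff G (nat k))" for k
      by (simp add: vnum_eq_coeff_euler_poly)
    from coeffs[OF _ this] show ?thesis using pgf(5) by simp
  qed
  ultimately show ?thesis unfolding D_def by blast
qed

end
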